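(* Let $f\colon U\to\mathbb{R}^3$ be a frontal and $p\in U$ a singular point of the first kind of $f$, where $U$ is sufficiently small. Let $\gamma$ be a singular curve through $p=\gamma(0)$. Let $\kappa_1=H+\sqrt{H^2-K}$ and $\kappa_2=H-\sqrt{H^2-K}$ be the principal curvatures of $f$. (1) If $p$ is a $2k$-non-front $(k\ge1)$ singular point of $f$, then one of the principal curvatures can be extended as a continuous function near $p$ and the other is unbounded near $p$. (2) If $p$ is a $(2k+1)$-non-front $(k\ge0)$ singular point of $f$, and $\kappa_\nu$ does not vanish at $0$, or has a finite multiplicity at $0$, then $\kappa_1$ is continuous on $U\setminus\gamma(\{t\le0\})$ but unbounded at $\gamma(\{t\le0\})$, and $\kappa_2$ is continuous on $U\setminus\gamma(\{t\ge0\})$ but unbounded at $\gamma(\{t\ge0\})$.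
   Context: Let $U\subset\mathbb{R}^2$ be open. A $C^\infty$ map $f\colon U\to\mathbb{R}^3$ is a frontal if there is a $C^\infty$ map $\nu\colon U\to S^2$ (unit normal vector, Gauss map) with $\langle df_q(X),\nu(q)\rangle=0$ for all $q\in U$, $X\in T_qU$. A point is singular if $f$ is not an immersion there; $S(f)$ is the set of singular points. Put $\lambda=\det(f_u,f_v,\nu)$ for coordinates $(u,v)$; $p\in S(f)$ is non-degenerate if $d\lambda(p)\ne0$. Then near $p$ the set $S(f)$ is parametrized by a regular $C^\infty$ curve $\gamma\colon(-\varepsilon,\varepsilon)\to U$ with $\gamma(0)=p$ (the singular curve), and there is a non-zero vector field $\eta$ near $p$ with $df_q(\eta_q)=0$ for $q\in S(f)$ (a null vector field). A non-degenerate singular point $p$ is of the first kind if $\eta$ is transverse to $\gamma$ at $p$. With $\hat\gamma=f\circ\gamma$ and $\psi(t)=\det(\hat\gamma'(t),\nu(\gamma(t)),(\eta\nu)(\gamma(t)))$, a singular point $p$ of the first kind is $k$-non-front ($k\ge1$) if $\psi(0)=\psi'(0)=\cdots=\psi^{(k-1)}(0)=0$ and $\psi^{(k)}(0)\ne0$. $\kappa_\nu$ is the limiting normal curvature along $\gamma$: $\kappa_\nu(t)=\langle\hat\gamma''(t),\nu(\gamma(t))\rangle/|\hat\gamma'(t)|^2$. A function $x$ is said to have finite multiplicity at $0$ if there exists an integer $l\ge2$ such that $x'(0)=\cdots=x^{(l-1)}(0)=0$ and $x^{(l)}(0)\ne0$. $K$ and $H$ are the Gaussian and mean curvatures of $f$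 with respect to $\nu$, defined on the set of regular points $U\setminus S(f)$, where $H^2-K\ge0$. Since $\kappa_1,\kappa_2$ are thereby given on regular points, continuity at points of the singular curve refers to continuous extension to those points.
   Formalization: The root in the principal curvatures carries the sign of λ; in (1) the extension is continuous off p, continuous along γ also at p, and bounded near p, but need not be continuous at p; (2) holds for one of the two orientations of γ. *)

theory Defs
  imports "HOL-Analysis.Analysis"
begin

text \<open>Meaningful for open domains: differentiability is required at the points, not within the set.\<close>

primrec Ck_on :: "nat \<Rightarrow> ('a::real_normed_vector \<Rightarrow> 'b::real_normed_vector) \<Rightarrow> 'a set \<Rightarrow> bool" where
  "Ck_on 0 f U \<longleftrightarrow> continuous_on U f"
| "Ck_on (Suc k) f U \<longleftrightarrow> (\<forall>x\<in>U. f differentiable (at x)) \<and>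
     (\<forall>w. Ck_on k (\<lambda>x. frechet_derivative f (at x) w) U)"

definition smooth_on :: "('a::real_normed_vector \<Rightarrow> 'b::real_normed_vector) \<Rightarrow> 'a set \<Rightarrow> bool" where
  "smooth_on f U \<longleftrightarrow> (\<forall>k. Ck_on k f U)"

definition D1 :: "(real^2 \<Rightarrow> 'b::real_normed_vector) \<Rightarrow> real^2 \<Rightarrow> 'b" where
  "D1 f q = frechet_derivative f (at q) (axis 1 1)"

definition D2 :: "(real^2 \<Rightarrow> 'b::real_normed_vector) \<Rightarrow> real^2 \<Rightarrow> 'b" where
  "D2 f q = frechet_derivative f (at q) (axis 2 1)"

definition det3 :: "real^3 \<Rightarrow> real^3 \<Rightarrow> real^3 \<Rightarrow> real" where
  "det3 a b c = det (vector [a, b, c] :: real^3^3)"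


section \<open>Frontals and singular points of the first kind\<close>

definition frontal :: "(real^2) set \<Rightarrow> (real^2 \<Rightarrow> real^3) \<Rightarrow> (real^2 \<Rightarrow> real^3) \<Rightarrow> bool" where
  "frontal U f \<nu> \<longleftrightarrow> open U \<and> smooth_on f U \<and> smooth_on \<nu> U \<and>
     (\<forall>q\<in>U. norm (\<nu> q) = 1) \<and>
     (\<forall>q\<in>U. \<forall>X. frechet_derivative f (at q) X \<bullet> \<nu> q = 0)"

definition sing_set :: "(real^2) set \<Rightarrow> (real^2 \<Rightarrow> real^3) \<Rightarrow> (real^2) set" where
  "sing_set U f = {q\<in>U. \<not> inj (frechet_derivative f (at q))}"

definition area_density :: "(real^2 \<Rightarrow> real^3) \<Rightarrow> (real^2 \<Rightarrow> real^3) \<Rightarrow> real^2 \<Rightarrow> real" where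
  "area_density f \<nu> q = det3 (D1 f q) (D2 f q) (\<nu> q)"

definition nondegenerate_sing_pt ::
    "(real^2) set \<Rightarrow> (real^2 \<Rightarrow> real^3) \<Rightarrow> (real^2 \<Rightarrow> real^3) \<Rightarrow> real^2 \<Rightarrow> bool" where
  "nondegenerate_sing_pt U f \<nu> p \<longleftrightarrow> p \<in> sing_set U f \<and>
     frechet_derivative (area_density f \<nu>) (at p) \<noteq> (\<lambda>X. 0)"

definition velocity :: "(real \<Rightarrow> 'b::real_normed_vector) \<Rightarrow> real \<Rightarrow> 'b" where
  "velocity c t = vector_derivative c (at t)"

text \<open>A parametrization of the whole singular set in some neighbourhood \<open>N\<close> of \<open>p\<close>.\<close>

definition singular_curve ::
    "(real^2) set \<Rightarrow> (real^2 \<Rightarrow> real^3) \<Rightarrow> real^2 \<Rightarrow> real \<Rightarrow> (real \<Rightarrow> real^2) \<Rightarrow> bool" where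
  "singular_curve U f p \<epsilon> \<gamma> \<longleftrightarrow> \<epsilon> > 0 \<and> smooth_on \<gamma> {-\<epsilon><..<\<epsilon>} \<and>
     (\<forall>t\<in>{-\<epsilon><..<\<epsilon>}. velocity \<gamma> t \<noteq> 0) \<and> inj_on \<gamma> {-\<epsilon><..<\<epsilon>} \<and> \<gamma> 0 = p \<and>
     (\<exists>N. open N \<and> p \<in> N \<and> N \<subseteq> U \<and> sing_set U f \<inter> N = \<gamma> ` {-\<epsilon><..<\<epsilon>})"

definition null_vector_field ::
    "(real^2) set \<Rightarrow> (real^2 \<Rightarrow> real^3) \<Rightarrow> real^2 \<Rightarrow> (real^2 \<Rightarrow> real^2) \<Rightarrow> bool" where
  "null_vector_field U f p \<eta> \<longleftrightarrow>
     (\<exists>N. open N \<and> p \<in> N \<and> N \<subseteq> U \<and> smooth_on \<eta> N \<and> (\<forall>q\<in>N. \<eta> q \<noteq> 0) \<and>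
          (\<forall>q\<in>sing_set U f \<inter> N. frechet_derivative f (at q) (\<eta> q) = 0))"

text \<open>
  The property does not depend on the choice of the singular curve \<open>\<gamma>\<close> and of the null vector
  field \<open>\<eta>\<close>; they are arguments because the notions below refer to them.
  Transversality of \<open>\<eta>\<close> to \<open>\<gamma>\<close> at \<open>p = \<gamma> 0\<close> is linear independence of \<open>\<gamma>'(0)\<close> and \<open>\<eta>(p)\<close>
  (both vectors are non-zero).
\<close>

definition first_kind ::
    "(real^2) set \<Rightarrow> (real^2 \<Rightarrow> real^3) \<Rightarrow> (real^2 \<Rightarrow> real^3) \<Rightarrow> real^2
      \<Rightarrow> real \<Rightarrow> (real \<Rightarrow> real^2) \<Rightarrow> (real^2 \<Rightarrow> real^2) \<Rightarrow> bool" where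
  "first_kind U f \<nu> p \<epsilon> \<gamma> \<eta> \<longleftrightarrow> nondegenerate_sing_pt U f \<nu> p \<and>
     singular_curve U f p \<epsilon> \<gamma> \<and> null_vector_field U f p \<eta> \<and>
     \<eta> p \<notin> span {velocity \<gamma> 0}"

definition psi ::
    "(real^2 \<Rightarrow> real^3) \<Rightarrow> (real^2 \<Rightarrow> real^3) \<Rightarrow> (real \<Rightarrow> real^2) \<Rightarrow> (real^2 \<Rightarrow> real^2)
      \<Rightarrow> real \<Rightarrow> real" where
  "psi f \<nu> \<gamma> \<eta> t = det3 (velocity (f \<circ> \<gamma>) t) (\<nu> (\<gamma> t))
     (frechet_derivative \<nu> (at (\<gamma> t)) (\<eta> (\<gamma> t)))"

definition non_front ::
    "nat \<Rightarrow> (real^2 \<Rightarrow> real^3) \<Rightarrow> (real^2 \<Rightarrow> real^3) \<Rightarrow> (real \<Rightarrow> real^2) \<Rightarrow> (real^2 \<Rightarrow> real^2)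
      \<Rightarrow> bool" where
  "non_front k f \<nu> \<gamma> \<eta> \<longleftrightarrow> k \<ge> 1 \<and> (\<forall>j<k. (deriv ^^ j) (psi f \<nu> \<gamma> \<eta>) 0 = 0) \<and>
     (deriv ^^ k) (psi f \<nu> \<gamma> \<eta>) 0 \<noteq> 0"

definition limiting_normal_curvature ::
    "(real^2 \<Rightarrow> real^3) \<Rightarrow> (real^2 \<Rightarrow> real^3) \<Rightarrow> (real \<Rightarrow> real^2) \<Rightarrow> real \<Rightarrow> real" where
  "limiting_normal_curvature f \<nu> \<gamma> t =
     (velocity (velocity (f \<circ> \<gamma>)) t \<bullet> \<nu> (\<gamma> t)) / (norm (velocity (f \<circ> \<gamma>) t))\<^sup>2"

definition finite_multiplicity_at_0 :: "(real \<Rightarrow> real) \<Rightarrow> bool" where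
  "finite_multiplicity_at_0 x \<longleftrightarrow>
     (\<exists>l\<ge>2. (\<forall>j\<in>{1..<l}. (deriv ^^ j) x 0 = 0) \<and> (deriv ^^ l) x 0 \<noteq> 0)"


section \<open>Curvatures\<close>

definition gauss_curvature ::
    "(real^2 \<Rightarrow> real^3) \<Rightarrow> (real^2 \<Rightarrow> real^3) \<Rightarrow> real^2 \<Rightarrow> real" where
  "gauss_curvature f \<nu> q =
    (let E = D1 f q \<bullet> D1 f q; F = D1 f q \<bullet> D2 f q; G = D2 f q \<bullet> D2 f q;
         L = D1 (D1 f) q \<bullet> \<nu> q; M = D2 (D1 f) q \<bullet> \<nu> q; N = D2 (D2 f) q \<bullet> \<nu> q
     in (L * N - M\<^sup>2) / (E * G - F\<^sup>2))"

definition mean_curvature ::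
    "(real^2 \<Rightarrow> real^3) \<Rightarrow> (real^2 \<Rightarrow> real^3) \<Rightarrow> real^2 \<Rightarrow> real" where
  "mean_curvature f \<nu> q =
    (let E = D1 f q \<bullet> D1 f q; F = D1 f q \<bullet> D2 f q; G = D2 f q \<bullet> D2 f q;
         L = D1 (D1 f) q \<bullet> \<nu> q; M = D2 (D1 f) q \<bullet> \<nu> q; N = D2 (D2 f) q \<bullet> \<nu> q
     in (E * N - 2 * F * M + G * L) / (2 * (E * G - F\<^sup>2)))"

text \<open>
  The square root in \<open>\<kappa>\<^sub>1\<close>, \<open>\<kappa>\<^sub>2\<close> = \<open>H \<plusminus> \<surd>(H\<^sup>2 - K)\<close>.  With \<open>\<lambda>\<close> the signed area density,
  \<open>\<lambda> H\<close> and \<open>\<lambda> K\<close> extend smoothly across the singular curve, and the branch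
  \<open>\<surd>(H\<^sup>2 - K) = \<surd>((\<lambda>H)\<^sup>2 - \<lambda>(\<lambda>K)) / \<lambda>\<close> is the one that continues across it.  It is the
  non-negative root where \<open>\<lambda> > 0\<close> and the non-positive root where \<open>\<lambda> < 0\<close>.  Taking the
  non-negative root on both sides would not work: \<open>H\<close> is taken with respect to the fixed smooth
  \<open>\<nu>\<close>, so near a cuspidal edge it tends to \<open>\<infinity>\<close> on one side and to \<open>-\<infinity>\<close> on the other, and both
  \<open>H + \<bar>\<dots>\<bar>\<close> and \<open>H - \<bar>\<dots>\<bar>\<close> would be unbounded there.

  Replacing \<open>\<nu>\<close> by \<open>-\<nu>\<close> negates \<open>\<kappa>\<^sub>1\<close> and \<open>\<kappa>\<^sub>2\<close> without exchanging them, but an orientation-reversing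
  change of the coordinates \<open>(u,v)\<close> exchanges them.  A statement that tells \<open>\<kappa>\<^sub>1\<close> from \<open>\<kappa>\<^sub>2\<close> on the two
  halves of \<open>\<gamma>\<close> therefore presupposes a suitable orientation of \<open>\<gamma>\<close>, i.e. \<open>\<gamma>\<close> has to be replaced by
  \<open>t \<mapsto> \<gamma> (\<sigma> * t)\<close> for a sign \<open>\<sigma>\<close>.
\<close>

definition root_H2_K :: "(real^2 \<Rightarrow> real^3) \<Rightarrow> (real^2 \<Rightarrow> real^3) \<Rightarrow> real^2 \<Rightarrow> real" where
  "root_H2_K f \<nu> q = sgn (area_density f \<nu> q) *
     sqrt ((mean_curvature f \<nu> q)\<^sup>2 - gauss_curvature f \<nu> q)"

definition kappa1 :: "(real^2 \<Rightarrow> real^3) \<Rightarrow> (real^2 \<Rightarrow> real^3) \<Rightarrow> real^2 \<Rightarrow> real" where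
  "kappa1 f \<nu> q = mean_curvature f \<nu> q + root_H2_K f \<nu> q"

definition kappa2 :: "(real^2 \<Rightarrow> real^3) \<Rightarrow> (real^2 \<Rightarrow> real^3) \<Rightarrow> real^2 \<Rightarrow> real" where
  "kappa2 f \<nu> q = mean_curvature f \<nu> q - root_H2_K f \<nu> q"


section \<open>Continuous extension and unboundedness\<close>

text \<open>
  In the following, \<open>h\<close> is a function that is given (only) on the regular points
  \<open>U - sing_set U f\<close>, and \<open>\<Sigma>\<close> stands for \<open>sing_set U f\<close>.
\<close>

definition extends_continuously ::
    "(real^2) set \<Rightarrow> (real^2 \<Rightarrow> real) \<Rightarrow> (real^2) set \<Rightarrow> bool" where
  "extends_continuously \<Sigma> h A \<longleftrightarrow>
     (\<exists>g. continuous_on A g \<and> (\<forall>q\<in>A - \<Sigma>. g q = h q))"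

text \<open>
  The sense in which the bounded principal curvature at a \<open>2k\<close>-non-front point \<open>p\<close> extends.
  The extension is continuous at every point of \<open>W\<close> other than \<open>p\<close>; at \<open>p\<close> itself it is locally
  bounded and continuous along \<open>\<Sigma>\<close>.  Unrestricted continuity at \<open>p\<close> fails in general: for
  \<open>f(u,v) = (u, v\<^sup>2, u v\<^sup>2 + u\<^sup>2 v\<^sup>3)\<close> the origin is \<open>2\<close>-non-front, the bounded principal curvature
  tends to \<open>0\<close> at every \<open>(u,0)\<close> with \<open>u \<noteq> 0\<close>, but on the axis \<open>u = 0\<close> both principal
  curvatures have absolute value tending to \<open>1\<close> at the origin.
\<close>

definition extends_continuously_near ::
    "(real^2) set \<Rightarrow> (real^2 \<Rightarrow> real) \<Rightarrow> (real^2) set \<Rightarrow> real^2 \<Rightarrow> bool" where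
  "extends_continuously_near \<Sigma> h W p \<longleftrightarrow>
     (\<exists>g. continuous_on (W - {p}) g \<and> continuous_on (W \<inter> \<Sigma>) g \<and> bounded (g ` W) \<and>
          (\<forall>q\<in>W - \<Sigma>. g q = h q))"

definition unbounded_near ::
    "(real^2) set \<Rightarrow> (real^2) set \<Rightarrow> (real^2 \<Rightarrow> real) \<Rightarrow> real^2 \<Rightarrow> bool" where
  "unbounded_near U \<Sigma> h q \<longleftrightarrow>
     (\<forall>V. open V \<longrightarrow> q \<in> V \<longrightarrow> \<not> bounded (h ` (V \<inter> (U - \<Sigma>))))"

end

theory Submission
  imports Defs
begin

text \<open>
  The products of the mean and of the Gaussian curvature with the signed area density \<open>\<lambda>\<close> are
  polynomials in the first derivatives of \<open>f\<close> and \<open>\<nu>\<close> (and in \<open>\<nu>\<close>), hence smooth functions \<open>A = \<lambda>H\<close> and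
  \<open>B = \<lambda>K\<close> across the singular set (\<open>curvature_quotients\<close>).  With a sign \<open>s\<close> for the branch, the
  principal curvatures are
  \<open>(A + s \<surd>(A\<^sup>2 - \<lambda>B)) / \<lambda> = B / (A - s \<surd>(A\<^sup>2 - \<lambda>B))\<close>.
  At a singular point with \<open>A \<noteq> 0\<close>, the first form shows that the branch whose sign is that of
  \<open>A\<close> is unbounded (\<open>unbounded_near_singular\<close>), and the second one that the other branch extends
  continuously with value \<open>B / (2A)\<close> (\<open>isCont_extension_singular\<close>).

  So everything depends on the sign of \<open>A\<close> along the singular curve.  In a frame that consists of
  the velocity of \<open>\<gamma>\<close> and the null vector \<open>\<eta>\<close>, one finds \<open>\<psi> = 2A\<close> up to the non-vanishing area of
  the frame (\<open>psi_sgn\<close>).  Hence at an \<open>m\<close>-non-front point \<open>A (\<gamma> t)\<close> has the sign of \<open>t\<^sup>m\<close> up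
  to a constant sign (\<open>mean_numerator_sign\<close>).  If \<open>m\<close> is odd, then the sign changes at \<open>0\<close>, each
  branch extends over one open half of \<open>\<gamma>\<close>, and it is unbounded on the other half and at its end
  point \<open>p\<close>.

  If \<open>m\<close> is even, one branch extends over all of \<open>\<gamma>\<close> near \<open>p\<close> except \<open>p\<close> itself, where \<open>A\<close>
  vanishes.  Two facts settle the behaviour at \<open>p\<close>.  First, the symmetry of the second fundamental
  form implies \<open>B = 2\<kappa>A\<close> on the singular set, where \<open>\<kappa>\<close> is the normal curvature
  (\<open>gauss_numerator_null\<close>); so along \<open>\<gamma>\<close> the extension is \<open>\<kappa>\<close>, which is continuous.  Second,
  non-degeneracy bounds the distance from \<open>\<gamma>\<close> by a constant times \<open>\<bar>\<lambda>\<bar>\<close>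
  (\<open>distance_to_singular_curve\<close>); so near \<open>p\<close> both the relation \<open>B = 2\<kappa>A\<close> and the sign condition
  on \<open>A\<close> hold up to an error \<open>O(\<lambda>)\<close>, which is exactly enough to bound the quotient
  (\<open>quadratic_root_bounded\<close>, \<open>bounded_branch_near_p\<close>).
\<close>

section \<open>Calculus of smooth maps\<close>

text \<open>Derivatives are taken at points rather than within the set, so agreement on an open set is
  enough to transfer regularity.\<close>

lemma Ck_on_cong:
  assumes "open U" "\<And>x. x \<in> U \<Longrightarrow> f x = g x" "Ck_on k f U"
  shows "Ck_on k g U"
  using assms(2,3)
proof (induction k arbitrary: f g)
  case 0
  then show ?case by (simp cong: continuous_on_cong)
next
  case (Suc k)
  have d: "f differentiable (at x)" if "x \<in> U" for x using Suc.prems(2) that by simp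
  have "g differentiable (at x)" if "x \<in> U" for x
    using d[OF that] Suc.prems(1) that assms(1)
    by (meson differentiable_def has_derivative_transform_within_open)
  moreover have "Ck_on k (\<lambda>x. frechet_derivative g (at x) w) U" for w
  proof (rule Suc.IH)
    show "Ck_on k (\<lambda>x. frechet_derivative f (at x) w) U" using Suc.prems(2) by simp
    show "frechet_derivative f (at x) w = frechet_derivative g (at x) w" if "x \<in> U" for x
      using frechet_derivative_transform_within_open[OF d[OF that] assms(1) that Suc.prems(1)] by simp
  qed
  ultimately show ?case by simp
qed

lemma Ck_on_SucD: "Ck_on (Suc k) f U \<Longrightarrow> Ck_on k f U"
proof (induction k arbitrary: f)
  case 0
  then show ?case
    by (auto intro!: continuous_at_imp_continuous_on differentiable_imp_continuous_within)
qed simp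

lemma Ck_on_has_derivative:
  "Ck_on (Suc k) f U \<Longrightarrow> x \<in> U \<Longrightarrow> (f has_derivative frechet_derivative f (at x)) (at x)"
  using frechet_derivative_works by auto

lemma Ck_on_imp_continuous_on: "Ck_on k f U \<Longrightarrow> continuous_on U f"
  by (induction k) (simp, blast dest: Ck_on_SucD)

lemma Ck_on_subset: "Ck_on k f U \<Longrightarrow> V \<subseteq> U \<Longrightarrow> Ck_on k f V"
  by (induction k arbitrary: f) (auto intro: continuous_on_subset)

lemma Ck_on_const: "Ck_on k (\<lambda>x. c) U"
  by (induction k arbitrary: c) auto

lemma Ck_on_add:
  assumes "open U" "Ck_on k f U" "Ck_on k g U"
  shows "Ck_on k (\<lambda>x. f x + g x) U"
  using assms(2,3)
proof (induction k arbitrary: f g)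
  case 0
  then show ?case by (simp add: continuous_on_add)
next
  case (Suc k)
  have *: "((\<lambda>x. f x + g x) has_derivative
      (\<lambda>w. frechet_derivative f (at x) w + frechet_derivative g (at x) w)) (at x)" if "x \<in> U" for x
    using Suc.prems that by (intro has_derivative_add Ck_on_has_derivative)
  have "Ck_on k (\<lambda>x. frechet_derivative (\<lambda>x. f x + g x) (at x) w) U" for w
    by (rule Ck_on_cong[OF assms(1) _ Suc.IH])
      (use Suc.prems frechet_derivative_at[OF *] in \<open>auto dest: fun_cong\<close>)
  then show ?case using * by (auto simp: differentiable_def)
qed

lemma Ck_on_sum:
  assumes "open U" "finite I" "\<And>i. i \<in> I \<Longrightarrow> Ck_on k (f i) U"
  shows "Ck_on k (\<lambda>x. \<Sum>i\<in>I. f i x) U"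
  using assms(2,3)
  by (induction I rule: finite_induct) (auto intro!: Ck_on_const Ck_on_add assms(1))

lemma (in bounded_bilinear) Ck_on:
  assumes "open U" "Ck_on k f U" "Ck_on k g U"
  shows "Ck_on k (\<lambda>x. prod (f x) (g x)) U"
  using assms(2,3)
proof (induction k arbitrary: f g)
  case 0
  then show ?case by (simp add: continuous_on)
next
  case (Suc k)
  have *: "((\<lambda>x. prod (f x) (g x)) has_derivative
      (\<lambda>w. prod (f x) (frechet_derivative g (at x) w) + prod (frechet_derivative f (at x) w) (g x))) (at x)"
    if "x \<in> U" for x
    using Suc.prems that by (intro FDERIV Ck_on_has_derivative)
  have "Ck_on k (\<lambda>x. prod (f x) (frechet_derivative g (at x) w) + prod (frechet_derivative f (at x) w) (g x)) U" for w
    using Suc.prems Suc.prems[THEN Ck_on_SucD] by (intro Ck_on_add Suc.IH assms(1)) auto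
  then have "Ck_on k (\<lambda>x. frechet_derivative (\<lambda>x. prod (f x) (g x)) (at x) w) U" for w
    by (rule Ck_on_cong[OF assms(1), rotated]) (use frechet_derivative_at[OF *] in \<open>auto dest: fun_cong\<close>)
  then show ?case using * by (auto simp: differentiable_def)
qed

text \<open>By the chain rule, \<open>D(f \<circ> g)\<close> is a sum of products of first derivatives of \<open>g\<close> with
  partial derivatives of \<open>f\<close> composed with \<open>g\<close>; so the order drops by one and the product
  rule applies.\<close>

lemma Ck_on_compose:
  fixes g :: "'a::real_normed_vector \<Rightarrow> 'b::euclidean_space" and f :: "'b \<Rightarrow> 'c::real_normed_vector"
  assumes "open V" "\<And>x. x \<in> V \<Longrightarrow> g x \<in> U" "Ck_on k f U" "Ck_on k g V"
  shows "Ck_on k (\<lambda>x. f (g x)) V"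
  using assms(3,4)
proof (induction k arbitrary: f)
  case 0
  then show ?case using assms(2) by (auto intro: continuous_on_compose2)
next
  case (Suc k)
  let ?D = "\<lambda>x w. \<Sum>b\<in>Basis. (frechet_derivative g (at x) w \<bullet> b) *\<^sub>R frechet_derivative f (at (g x)) b"
  have *: "((\<lambda>x. f (g x)) has_derivative ?D x) (at x)" if "x \<in> V" for x
  proof -
    have f: "(f has_derivative frechet_derivative f (at (g x))) (at (g x))"
      using Suc.prems(1) assms(2)[OF that] by (rule Ck_on_has_derivative)
    have "((\<lambda>x. f (g x)) has_derivative
        (\<lambda>w. frechet_derivative f (at (g x)) (frechet_derivative g (at x) w))) (at x)"
      using diff_chain_at[OF Ck_on_has_derivative[OF Suc.prems(2) that] f] by (simp add: o_def)
    moreover have "frechet_derivative f (at (g x)) v =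
        (\<Sum>b\<in>Basis. (v \<bullet> b) *\<^sub>R frechet_derivative f (at (g x)) b)" for v
      using has_derivative_linear[OF f]
      by (subst (1) euclidean_representation[of v, symmetric]) (simp only: linear_sum linear_scale)
    ultimately show ?thesis by (rule has_derivative_eq_rhs[OF _ ext])
  qed
  have "Ck_on k (\<lambda>x. ?D x w) V" for w
    using Suc.prems Ck_on_SucD[OF Suc.prems(2)]
    by (intro Ck_on_sum bounded_bilinear.Ck_on[OF bounded_bilinear_scaleR] Suc.IH assms(1)
        bounded_bilinear.Ck_on[OF bounded_bilinear_inner] Ck_on_const) auto
  then have "Ck_on k (\<lambda>x. frechet_derivative (\<lambda>x. f (g x)) (at x) w) V" for w
    by (rule Ck_on_cong[OF assms(1), rotated]) (use frechet_derivative_at[OF *] in \<open>auto dest: fun_cong\<close>)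
  then show ?case using * by (auto simp: differentiable_def)
qed

lemma smooth_on_Ck_on: "smooth_on f U \<Longrightarrow> Ck_on k f U"
  by (simp add: smooth_on_def)

lemma smooth_on_directional: "smooth_on f U \<Longrightarrow> smooth_on (\<lambda>x. frechet_derivative f (at x) w) U"
  unfolding smooth_on_def by (metis Ck_on.simps(2))

lemma DERIV_along_line:
  fixes g :: "'a::real_normed_vector \<Rightarrow> real"
  assumes "g differentiable (at (a + s *\<^sub>R v))"
  shows "((\<lambda>s. g (a + s *\<^sub>R v)) has_field_derivative frechet_derivative g (at (a + s *\<^sub>R v)) v) (at s)"
proof -
  let ?D = "frechet_derivative g (at (a + s *\<^sub>R v))"
  have D: "(g has_derivative ?D) (at (a + s *\<^sub>R v))" using assms frechet_derivative_works by blast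
  have "((\<lambda>s. a + s *\<^sub>R v) has_derivative (\<lambda>h. h *\<^sub>R v)) (at s)"
    by (auto intro!: derivative_eq_intros)
  then have "((\<lambda>s. g (a + s *\<^sub>R v)) has_derivative (\<lambda>h. ?D (h *\<^sub>R v))) (at s)"
    using diff_chain_at[of "\<lambda>s. a + s *\<^sub>R v" _ s g ?D] D by (simp add: o_def)
  then show ?thesis
    using linear_scale[OF has_derivative_linear[OF D]]
    by (simp add: has_field_derivative_def mult.commute[of _ "?D v"])
qed

text \<open>The second difference over the parallelogram with edges \<open>h v\<close> and \<open>h w\<close>, computed by two
  applications of the mean value theorem.  The difference is symmetric in \<open>v\<close> and \<open>w\<close>, which
  is where the symmetry of second derivatives comes from.\<close>

lemma second_difference_mvt:
  fixes g :: "'a::real_normed_vector \<Rightarrow> real"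
  assumes C2: "Ck_on 2 g U" and ball: "ball q R \<subseteq> U" and h: "h > 0" "h * (norm v + norm w) < R"
  shows "\<exists>x\<in>ball q R. g (q + h *\<^sub>R v + h *\<^sub>R w) - g (q + h *\<^sub>R v) - g (q + h *\<^sub>R w) + g q =
    h * h * frechet_derivative (\<lambda>x. frechet_derivative g (at x) v) (at x) w"
proof -
  have C: "Ck_on (Suc (Suc 0)) g U" using C2 by (simp add: numeral_2_eq_2)
  have inb: "q + s *\<^sub>R v + r *\<^sub>R w \<in> ball q R" if "0 \<le> s" "s \<le> h" "0 \<le> r" "r \<le> h" for s r
  proof -
    have "norm (s *\<^sub>R v + r *\<^sub>R w) \<le> s * norm v + r * norm w"
      using norm_triangle_ineq[of "s *\<^sub>R v" "r *\<^sub>R w"] that by simp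
    also have "\<dots> \<le> h * norm v + h * norm w"
      using that by (intro add_mono mult_right_mono) auto
    finally have "norm (- (s *\<^sub>R v + r *\<^sub>R w)) < R"
      using h(2) by (simp only: norm_minus_cancel) (simp add: algebra_simps)
    then show ?thesis by (simp add: dist_norm algebra_simps)
  qed
  define \<phi> where "\<phi> s = g (q + h *\<^sub>R w + s *\<^sub>R v) - g (q + s *\<^sub>R v)" for s
  define \<phi>' where "\<phi>' s = frechet_derivative g (at (q + h *\<^sub>R w + s *\<^sub>R v)) v
      - frechet_derivative g (at (q + s *\<^sub>R v)) v" for s
  have "(\<phi> has_field_derivative \<phi>' s) (at s)" if "0 \<le> s" "s \<le> h" for s
    unfolding \<phi>_def \<phi>'_def
    using inb[OF that, of h] inb[OF that, of 0] h ball C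
    by (intro DERIV_diff DERIV_along_line) (auto simp: algebra_simps)
  then obtain s where s: "0 < s" "s < h" "\<phi> h - \<phi> 0 = (h - 0) * \<phi>' s"
    using MVT2[OF h(1), of \<phi> \<phi>'] by blast
  define \<theta> where "\<theta> r = frechet_derivative g (at (q + s *\<^sub>R v + r *\<^sub>R w)) v" for r
  define \<theta>' where
    "\<theta>' r = frechet_derivative (\<lambda>x. frechet_derivative g (at x) v) (at (q + s *\<^sub>R v + r *\<^sub>R w)) w" for r
  have "(\<theta> has_field_derivative \<theta>' r) (at r)" if "0 \<le> r" "r \<le> h" for r
    unfolding \<theta>_def \<theta>'_def
    using inb[of s r] that s h ball C by (intro DERIV_along_line) auto
  then obtain r where r: "0 < r" "r < h" "\<theta> h - \<theta> 0 = (h - 0) * \<theta>' r"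
    using MVT2[OF h(1), of \<theta> \<theta>'] by blast
  \<comment> \<open>The second application is in the direction \<open>w\<close>, to the derivative in the direction \<open>v\<close>.\<close>
  have "\<phi>' s = \<theta> h - \<theta> 0" by (simp add: \<phi>'_def \<theta>_def algebra_simps)
  then have "\<phi> h - \<phi> 0 = h * h * \<theta>' r" using s(3) r(3) by simp
  then show ?thesis
    using inb[of s r] s r by (intro bexI[of _ "q + s *\<^sub>R v + r *\<^sub>R w"])
      (auto simp: \<phi>_def \<theta>'_def algebra_simps)
qed

text \<open>If the two mixed derivatives differed at \<open>q\<close>, continuity would keep them apart on a whole
  ball, on which both of them attain the same normalized second difference.\<close>

lemma symmetric_second_derivative_real:
  fixes g :: "'a::real_normed_vector \<Rightarrow> real"
  assumes "open U" and C2: "Ck_on 2 g U" and q: "q \<in> U"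
  shows "frechet_derivative (\<lambda>x. frechet_derivative g (at x) v) (at q) w =
    frechet_derivative (\<lambda>x. frechet_derivative g (at x) w) (at q) v"
proof (rule ccontr)
  define S where "S v w x = frechet_derivative (\<lambda>x. frechet_derivative g (at x) v) (at x) w" for v w x
  assume "\<not> ?thesis"
  then have ne: "S v w q \<noteq> S w v q" by (simp add: S_def)
  define e where "e = \<bar>S v w q - S w v q\<bar> / 2"
  have e: "e > 0" using ne by (simp add: e_def)
  have cont: "continuous_on U (S v w)" for v w
    using C2 unfolding S_def by (simp add: numeral_2_eq_2)
  have ev: "\<forall>\<^sub>F x in nhds q. \<bar>S v w x - S v w q\<bar> < e" for v w
  proof -
    have "isCont (S v w) q" using cont assms(1) q continuous_on_eq_continuous_at by blast
    then have "((\<lambda>x. S v w x - S v w q) \<longlongrightarrow> S v w q - S v w q) (nhds q)"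
      by (intro tendsto_diff tendsto_const) (simp add: isCont_def tendsto_at_iff_tendsto_nhds)
    then show ?thesis using e by (auto simp: tendsto_iff dist_norm)
  qed
  have "\<forall>\<^sub>F x in nhds q. x \<in> U \<and> \<bar>S v w x - S v w q\<bar> < e \<and> \<bar>S w v x - S w v q\<bar> < e"
    using ev eventually_nhds_in_open[OF assms(1) q] by (intro eventually_conj) auto
  then obtain R where R: "R > 0"
    "\<And>x. dist x q < R \<Longrightarrow> x \<in> U \<and> \<bar>S v w x - S v w q\<bar> < e \<and> \<bar>S w v x - S w v q\<bar> < e"
    unfolding eventually_nhds_metric by blast
  define h where "h = R / (norm v + norm w + 1)"
  have pos: "norm v + norm w + 1 > 0" by (simp add: add_nonneg_pos)
  then have h: "h > 0" using R(1) by (simp add: h_def)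
  have "h * (norm v + norm w) < h * (norm v + norm w + 1)" using h by simp
  also have "\<dots> = R" using pos by (simp add: h_def)
  finally have hR: "h * (norm v + norm w) < R" .
  then have hR': "h * (norm w + norm v) < R" by (simp add: add.commute)
  have ball: "ball q R \<subseteq> U" using R(2) by (auto simp: dist_commute)
  obtain x where x: "x \<in> ball q R" and
    x1: "g (q + h *\<^sub>R v + h *\<^sub>R w) - g (q + h *\<^sub>R v) - g (q + h *\<^sub>R w) + g q = h * h * S v w x"
    using second_difference_mvt[OF C2 ball h hR] unfolding S_def by blast
  obtain y where y: "y \<in> ball q R" and
    y1: "g (q + h *\<^sub>R w + h *\<^sub>R v) - g (q + h *\<^sub>R w) - g (q + h *\<^sub>R v) + g q = h * h * S w v y"
    using second_difference_mvt[OF C2 ball h hR'] unfolding S_def by blast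
  have "q + h *\<^sub>R w + h *\<^sub>R v = q + h *\<^sub>R v + h *\<^sub>R w" by (simp add: algebra_simps)
  then have "g (q + h *\<^sub>R w + h *\<^sub>R v) = g (q + h *\<^sub>R v + h *\<^sub>R w)" by (rule arg_cong)
  then have "h * h * S v w x = h * h * S w v y" using x1 y1 by linarith
  then have "S v w x = S w v y" using h by simp
  moreover have "\<bar>S v w x - S v w q\<bar> < e" "\<bar>S w v y - S w v q\<bar> < e"
    using R(2)[of x] R(2)[of y] x y by (auto simp: dist_commute)
  ultimately show False unfolding e_def by (simp add: abs_if split: if_splits)
qed

lemma frechet_derivative_inner_const:
  assumes "f differentiable (at x)"
  shows "frechet_derivative (\<lambda>x. f x \<bullet> e) (at x) = (\<lambda>w. frechet_derivative f (at x) w \<bullet> e)"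
  using assms frechet_derivative_works
  by (intro frechet_derivative_at[symmetric] has_derivative_inner_left) blast

lemma symmetric_second_derivative:
  fixes f :: "'a::real_normed_vector \<Rightarrow> 'b::real_inner"
  assumes U: "open U" and f: "smooth_on f U" and q: "q \<in> U"
  shows "frechet_derivative (\<lambda>x. frechet_derivative f (at x) v) (at q) w =
    frechet_derivative (\<lambda>x. frechet_derivative f (at x) w) (at q) v"
proof (rule vector_eq_ldot[THEN iffD1], intro allI)
  fix e :: 'b
  have fd: "f differentiable (at x)" if "x \<in> U" for x
    using smooth_on_Ck_on[OF f, of 1] that by simp
  have fd2: "(\<lambda>x. frechet_derivative f (at x) v) differentiable (at q)" for v
    using smooth_on_Ck_on[OF smooth_on_directional[OF f], of 1] q by simp
  have C: "Ck_on 2 (\<lambda>x. f x \<bullet> e) U"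
    by (intro bounded_bilinear.Ck_on[OF bounded_bilinear_inner] U smooth_on_Ck_on[OF f] Ck_on_const)
  have "frechet_derivative (\<lambda>x. frechet_derivative (\<lambda>x. f x \<bullet> e) (at x) v) (at q) w
      = frechet_derivative (\<lambda>x. frechet_derivative f (at x) v) (at q) w \<bullet> e" for v w
  proof -
    have "(\<lambda>x. frechet_derivative (\<lambda>x. f x \<bullet> e) (at x) v) differentiable (at q)"
      using C q by (simp add: numeral_2_eq_2)
    then have "frechet_derivative (\<lambda>x. frechet_derivative (\<lambda>x. f x \<bullet> e) (at x) v) (at q)
        = frechet_derivative (\<lambda>x. frechet_derivative f (at x) v \<bullet> e) (at q)"
      using frechet_derivative_inner_const[OF fd]
      by (intro frechet_derivative_transform_within_open[OF _ U q]) (auto dest: fun_cong)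
    then show ?thesis using frechet_derivative_inner_const[OF fd2] by metis
  qed
  then show "e \<bullet> frechet_derivative (\<lambda>x. frechet_derivative f (at x) v) (at q) w =
    e \<bullet> frechet_derivative (\<lambda>x. frechet_derivative f (at x) w) (at q) v"
    using symmetric_second_derivative_real[OF U C q, of v w] by (simp add: inner_commute)
qed

lemma sgn_eq_if_close: "\<bar>x - y\<bar> < \<bar>y\<bar> \<Longrightarrow> sgn x = sgn y" for x y :: real
  by (cases x "0::real" rule: linorder_cases; cases y "0::real" rule: linorder_cases) auto

lemma isCont_tendsto_nhds: "isCont f x \<Longrightarrow> (f \<longlongrightarrow> f x) (nhds x)"
  by (simp add: isCont_def tendsto_at_iff_tendsto_nhds)

text \<open>The operator norm of the derivative is at most the sum of the norms of the partial
  derivatives, which are continuous and hence bounded near \<open>p\<close>.\<close>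

lemma C1_locally_Lipschitz:
  fixes g :: "'a::euclidean_space \<Rightarrow> real"
  assumes "open U" "Ck_on 1 g U" "p \<in> U"
  shows "\<exists>R>0. \<exists>C\<ge>0. \<forall>x\<in>ball p R. \<forall>y\<in>ball p R. \<bar>g x - g y\<bar> \<le> C * norm (x - y)"
proof -
  let ?D = "\<lambda>b x. frechet_derivative g (at x) b"
  have d: "(g has_derivative frechet_derivative g (at x)) (at x)" if "x \<in> U" for x
    using assms(2) that by (intro Ck_on_has_derivative[of 0]) auto
  have "isCont (?D b) p" for b
    using assms continuous_on_eq_continuous_at[of U "?D b"] by auto
  then have "\<forall>\<^sub>F x in nhds p. norm (?D b x) < norm (?D b p) + 1" for b
    by (intro order_tendstoD(2)[OF tendsto_norm[OF isCont_tendsto_nhds]]) auto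
  then have "\<forall>\<^sub>F x in nhds p. x \<in> U \<and> (\<forall>b\<in>Basis. norm (?D b x) < norm (?D b p) + 1)"
    using eventually_nhds_in_open[OF assms(1,3)]
    by (intro eventually_conj eventually_ball_finite) auto
  then obtain R where R: "R > 0" "\<And>x. dist x p < R \<Longrightarrow> x \<in> U \<and> (\<forall>b\<in>Basis. norm (?D b x) < norm (?D b p) + 1)"
    unfolding eventually_nhds_metric by blast
  define C where "C = (\<Sum>b\<in>(Basis::'a set). norm (?D b p) + 1)"
  have "norm (g x - g y) \<le> C * norm (x - y)" if "x \<in> ball p R" "y \<in> ball p R" for x y
  proof (rule differentiable_bound[OF convex_ball[of p R] _ _ that])
    fix z assume "z \<in> ball p R"
    then have z: "z \<in> U" "\<forall>b\<in>Basis. norm (?D b z) < norm (?D b p) + 1"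
      using R(2)[of z] by (auto simp: dist_commute)
    show "(g has_derivative frechet_derivative g (at z)) (at z within ball p R)"
      by (rule has_derivative_at_withinI[OF d[OF z(1)]])
    have "onorm (frechet_derivative g (at z)) \<le> (\<Sum>b\<in>Basis. norm (?D b z))"
      by (rule onorm_componentwise[OF has_derivative_bounded_linear[OF d[OF z(1)]]])
    also have "\<dots> \<le> C" unfolding C_def using z(2) by (intro sum_mono) auto
    finally show "onorm (frechet_derivative g (at z)) \<le> C" .
  qed
  moreover have "C \<ge> 0" unfolding C_def by (intro sum_nonneg) auto
  ultimately have "\<forall>x\<in>ball p R. \<forall>y\<in>ball p R. \<bar>g x - g y\<bar> \<le> C * norm (x - y)" "C \<ge> 0"
    by (auto simp only: real_norm_def)
  then show ?thesis using R(1) by blast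
qed

lemma isCont_cong_near:
  assumes "open V" "q \<in> V" "\<And>x. x \<in> V \<Longrightarrow> g x = h x" "isCont g q"
  shows "isCont h q"
proof -
  have "\<forall>\<^sub>F x in nhds q. g x = h x"
    using eventually_nhds_in_open[OF assms(1,2)] by eventually_elim (rule assms(3))
  then show ?thesis using assms(4) isCont_cong by blast
qed

text \<open>By induction on the order: if the derivative of \<open>\<psi>\<close> has the sign of \<open>c t\<^sup>m\<close> and \<open>\<psi>\<close>
  vanishes at \<open>0\<close>, then \<open>\<psi>\<close> has the sign of \<open>c t\<^sup>m\<^sup>+\<^sup>1\<close>, because \<open>\<psi> t\<close> is \<open>t\<close> times a value of the
  derivative between \<open>0\<close> and \<open>t\<close>.  Finite differentiability up to order \<open>m\<close> is what makes the
  iterated derivatives at \<open>0\<close> meaningful.\<close>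

lemma sgn_at_zero_of_finite_order:
  fixes \<psi> :: "real \<Rightarrow> real"
  assumes "\<delta> > 0" "Ck_on m \<psi> {-\<delta><..<\<delta>}" "\<forall>j<m. (deriv ^^ j) \<psi> 0 = 0" "(deriv ^^ m) \<psi> 0 \<noteq> 0"
  shows "\<exists>\<delta>'>0. \<forall>t. t \<noteq> 0 \<longrightarrow> \<bar>t\<bar> < \<delta>' \<longrightarrow> sgn (\<psi> t) = sgn ((deriv ^^ m) \<psi> 0) * sgn t ^ m"
  using assms(2-)
proof (induction m arbitrary: \<psi>)
  case 0
  have "isCont \<psi> 0" using 0 assms(1) continuous_on_eq_continuous_at[of "{-\<delta><..<\<delta>}" \<psi>] by auto
  then have "\<forall>\<^sub>F t in nhds 0. dist (\<psi> t) (\<psi> 0) < \<bar>\<psi> 0\<bar>"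
    using 0 by (intro tendstoD[OF isCont_tendsto_nhds]) auto
  then obtain \<delta>' where "\<delta>' > 0" "\<And>t. dist t 0 < \<delta>' \<Longrightarrow> dist (\<psi> t) (\<psi> 0) < \<bar>\<psi> 0\<bar>"
    unfolding eventually_nhds_metric by blast
  then show ?case
    by (intro exI[of _ \<delta>']) (simp add: dist_real_def sgn_eq_if_close)
next
  case (Suc m)
  have d: "(\<psi> has_field_derivative deriv \<psi> t) (at t)" if "\<bar>t\<bar> < \<delta>" for t
  proof -
    have "\<psi> differentiable (at t)" using Suc.prems(1) that by (auto simp: abs_less_iff)
    then show ?thesis by (simp add: DERIV_deriv_iff_real_differentiable)
  qed
  have "Ck_on m (\<lambda>t. frechet_derivative \<psi> (at t) 1) {-\<delta><..<\<delta>}" using Suc.prems(1) by simp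
  then have C: "Ck_on m (deriv \<psi>) {-\<delta><..<\<delta>}"
  proof (rule Ck_on_cong[rotated 2])
    fix t assume "t \<in> {-\<delta><..<\<delta>}"
    then have "\<bar>t\<bar> < \<delta>" by auto
    from frechet_derivative_at[OF d[OF this, unfolded has_field_derivative_def]]
    show "frechet_derivative \<psi> (at t) 1 = deriv \<psi> t" by (metis mult.right_neutral)
  qed auto
  have z: "\<psi> 0 = 0" using Suc.prems(2) by (metis funpow_0 zero_less_Suc)
  have "\<forall>j<m. (deriv ^^ j) (deriv \<psi>) 0 = 0" using Suc.prems(2)
    by (metis Suc_less_eq comp_apply funpow_Suc_right)
  then obtain \<delta>' where \<delta>': "\<delta>' > 0"
    "\<And>t. t \<noteq> 0 \<Longrightarrow> \<bar>t\<bar> < \<delta>' \<Longrightarrow> sgn (deriv \<psi> t) = sgn ((deriv ^^ Suc m) \<psi> 0) * sgn t ^ m"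
    using Suc.IH[OF C] Suc.prems(3) by (auto simp: funpow_Suc_right simp del: funpow.simps)
  have "sgn (\<psi> t) = sgn ((deriv ^^ Suc m) \<psi> 0) * sgn t ^ Suc m"
    if "t \<noteq> 0" "\<bar>t\<bar> < min \<delta> \<delta>'" for t
  proof (cases "t > 0")
    case True
    have "(\<psi> has_field_derivative deriv \<psi> x) (at x)" if "0 \<le> x" "x \<le> t" for x
      using d[of x] \<open>\<bar>t\<bar> < min \<delta> \<delta>'\<close> that by simp
    from MVT2[OF True this] obtain \<xi> where
      \<xi>: "0 < \<xi>" "\<xi> < t" "\<psi> t - \<psi> 0 = (t - 0) * deriv \<psi> \<xi>" by blast
    then show ?thesis using \<delta>'(2)[of \<xi>] that True z by (simp add: sgn_mult)
  next
    case False
    then have t: "t < 0" using that by simp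
    have "(\<psi> has_field_derivative deriv \<psi> x) (at x)" if "t \<le> x" "x \<le> 0" for x
      using d[of x] \<open>\<bar>t\<bar> < min \<delta> \<delta>'\<close> that by simp
    from MVT2[OF t this] obtain \<xi> where
      \<xi>: "t < \<xi>" "\<xi> < 0" "\<psi> 0 - \<psi> t = (0 - t) * deriv \<psi> \<xi>" by blast
    then have "\<psi> t = t * deriv \<psi> \<xi>" using z by simp
    then show ?thesis using \<delta>'(2)[of \<xi>] that t \<xi> by (simp add: sgn_mult)
  qed
  then show ?case using assms(1) \<delta>'(1) by (intro exI[of _ "min \<delta> \<delta>'"]) auto
qed

section \<open>Determinants in the tangent plane\<close>

lemma det3_cross: "det3 a b c = a \<bullet> cross3 b c"
  by (simp add: det3_def dot_cross_det)

text \<open>On the plane orthogonal to a unit vector \<open>n\<close>, the form \<open>det3 a b n\<close> is the oriented area, and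
  the product of two areas is a Gram determinant.\<close>

lemma det3_gram:
  assumes "n \<bullet> n = 1" "a \<bullet> n = 0" "b \<bullet> n = 0" "c \<bullet> n = 0" "d \<bullet> n = 0"
  shows "det3 a b n * det3 c d n = (a \<bullet> c) * (b \<bullet> d) - (a \<bullet> d) * (b \<bullet> c)"
proof -
  have "det3 a b n * det3 c d n =
      (a \<bullet> c) * ((b \<bullet> d) * (n \<bullet> n) - (b \<bullet> n) * (d \<bullet> n)) - (a \<bullet> d) * ((b \<bullet> c) * (n \<bullet> n) - (b \<bullet> n) * (c \<bullet> n))
      + (a \<bullet> n) * ((b \<bullet> c) * (d \<bullet> n) - (b \<bullet> d) * (c \<bullet> n))"
    by (simp add: det3_def det_3 inner_vec_def sum_3 algebra_simps)
  then show ?thesis using assms by simp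
qed

text \<open>Cramer's rule expresses the linear dependence of the four vectors \<open>a, c, d, n\<close> of
  three-dimensional space; this is its inner product with \<open>a\<close>.\<close>

lemma det3_linear_dependency:
  "(a \<bullet> a) * det3 c d n - (a \<bullet> c) * det3 a d n + (a \<bullet> d) * det3 a c n - (a \<bullet> n) * det3 a c d = 0"
  by (simp add: det3_def det_3 inner_vec_def sum_3 algebra_simps)

lemma det3_swap: "det3 a n d = - det3 a d n" and det3_swap': "det3 b a n = - det3 a b n"
  by (simp_all add: det3_def det_3 algebra_simps)

definition area2 :: "real^2 \<Rightarrow> real^2 \<Rightarrow> real" where
  "area2 X Y = X $ 1 * Y $ 2 - X $ 2 * Y $ 1"

lemma det3_combination:
  "det3 (X$1 *\<^sub>R a + X$2 *\<^sub>R b) (Y$1 *\<^sub>R c + Y$2 *\<^sub>R d) n =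
    X$1 * Y$1 * det3 a c n + X$1 * Y$2 * det3 a d n + X$2 * Y$1 * det3 b c n + X$2 * Y$2 * det3 b d n"
  by (simp add: det3_def det_3 algebra_simps)

lemma Ck_on_det3:
  assumes "open U" "Ck_on k a U" "Ck_on k b U" "Ck_on k c U"
  shows "Ck_on k (\<lambda>x. det3 (a x) (b x) (c x)) U"
  unfolding det3_cross
  by (intro bounded_bilinear.Ck_on[OF bounded_bilinear_inner] assms
      bounded_bilinear.Ck_on[OF bilinear_cross[unfolded bilinear_conv_bounded_bilinear]])

lemma vec2_expand: "X = X $ 1 *\<^sub>R axis 1 1 + X $ 2 *\<^sub>R axis 2 (1::real)" for X :: "real^2"
  by (simp add: vec_eq_iff forall_2 axis_def)

section \<open>The curvatures of a frontal as quotients\<close>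

text \<open>With \<open>\<lambda>\<close> the signed area density, these are the products \<open>\<lambda>H\<close> and \<open>\<lambda>K\<close>, written through
  first derivatives of \<open>f\<close> and \<open>\<nu>\<close> so that they are smooth across the singular set.\<close>

definition mean_numerator :: "(real^2 \<Rightarrow> real^3) \<Rightarrow> (real^2 \<Rightarrow> real^3) \<Rightarrow> real^2 \<Rightarrow> real" where
  "mean_numerator f \<nu> q =
    (- 1 / 2) * (det3 (D1 \<nu> q) (D2 f q) (\<nu> q) + det3 (D1 f q) (D2 \<nu> q) (\<nu> q))"

definition gauss_numerator :: "(real^2 \<Rightarrow> real^3) \<Rightarrow> (real^2 \<Rightarrow> real^3) \<Rightarrow> real^2 \<Rightarrow> real" where
  "gauss_numerator f \<nu> q = det3 (D1 \<nu> q) (D2 \<nu> q) (\<nu> q)"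

text \<open>A sign \<open>s\<close> selects the branch, so that both principal curvatures are treated at once.\<close>

definition principal_curvature ::
    "real \<Rightarrow> (real^2 \<Rightarrow> real^3) \<Rightarrow> (real^2 \<Rightarrow> real^3) \<Rightarrow> real^2 \<Rightarrow> real" where
  "principal_curvature s f \<nu> q = mean_curvature f \<nu> q + s * root_H2_K f \<nu> q"

lemma kappa1_eq: "kappa1 f \<nu> = principal_curvature 1 f \<nu>"
  and kappa2_eq: "kappa2 f \<nu> = principal_curvature (- 1) f \<nu>"
  by (auto simp: kappa1_def kappa2_def principal_curvature_def)

locale frontal_surface =
  fixes U :: "(real^2) set" and f \<nu> :: "real^2 \<Rightarrow> real^3"
  assumes frontal: "frontal U f \<nu>"
begin

abbreviation "\<Lambda> \<equiv> area_density f \<nu>"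
abbreviation "A \<equiv> mean_numerator f \<nu>"
abbreviation "B \<equiv> gauss_numerator f \<nu>"
abbreviation "Df q X \<equiv> frechet_derivative f (at q) X"
abbreviation "D\<nu> q X \<equiv> frechet_derivative \<nu> (at q) X"

lemma U: "open U" and smooth_f: "smooth_on f U" and smooth_\<nu>: "smooth_on \<nu> U"
  and norm_\<nu>: "q \<in> U \<Longrightarrow> norm (\<nu> q) = 1"
  and tangent_f: "q \<in> U \<Longrightarrow> Df q X \<bullet> \<nu> q = 0"
  using frontal by (auto simp: frontal_def)

lemma Ck_on_D: "Ck_on k (D1 f) U" "Ck_on k (D2 f) U" "Ck_on k (D1 \<nu>) U" "Ck_on k (D2 \<nu>) U"
  unfolding D1_def[abs_def] D2_def[abs_def]
  using smooth_f smooth_\<nu> by (simp_all add: smooth_on_Ck_on smooth_on_directional)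

lemma Ck_on_area_density: "Ck_on k \<Lambda> U"
  unfolding area_density_def[abs_def] using smooth_\<nu>
  by (intro Ck_on_det3 U Ck_on_D smooth_on_Ck_on)

lemma Ck_on_gauss_numerator: "Ck_on k B U"
  unfolding gauss_numerator_def[abs_def] using smooth_\<nu>
  by (intro Ck_on_det3 U Ck_on_D smooth_on_Ck_on)

lemma Ck_on_mean_numerator: "Ck_on k A U"
  unfolding mean_numerator_def[abs_def] using smooth_\<nu>
  by (intro bounded_bilinear.Ck_on[OF bounded_bilinear_mult] Ck_on_const Ck_on_add
      Ck_on_det3 U Ck_on_D smooth_on_Ck_on)

lemma has_derivative_f: "q \<in> U \<Longrightarrow> (f has_derivative Df q) (at q)"
  and has_derivative_\<nu>: "q \<in> U \<Longrightarrow> (\<nu> has_derivative D\<nu> q) (at q)"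
  using smooth_on_Ck_on[OF smooth_f] smooth_on_Ck_on[OF smooth_\<nu>] Ck_on_has_derivative by blast+

lemma Df_expand: "q \<in> U \<Longrightarrow> Df q X = X$1 *\<^sub>R D1 f q + X$2 *\<^sub>R D2 f q"
  and D\<nu>_expand: "q \<in> U \<Longrightarrow> D\<nu> q X = X$1 *\<^sub>R D1 \<nu> q + X$2 *\<^sub>R D2 \<nu> q"
  unfolding D1_def D2_def
  using has_derivative_linear[OF has_derivative_f] has_derivative_linear[OF has_derivative_\<nu>]
  by (subst vec2_expand[of X], simp only: linear_add linear_scale)+

lemma tangent_\<nu>:
  assumes q: "q \<in> U"
  shows "D\<nu> q X \<bullet> \<nu> q = 0"
proof -
  have "((\<lambda>x. \<nu> x \<bullet> \<nu> x) has_derivative (\<lambda>X. \<nu> q \<bullet> D\<nu> q X + D\<nu> q X \<bullet> \<nu> q)) (at q)"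
    by (intro has_derivative_inner has_derivative_\<nu> q)
  moreover have "((\<lambda>x. \<nu> x \<bullet> \<nu> x) has_derivative (\<lambda>X. 0)) (at q)"
    by (rule has_derivative_transform_within_open[OF has_derivative_const[of 1] U q])
      (use norm_\<nu> in \<open>simp add: dot_square_norm\<close>)
  ultimately have "(\<lambda>X. \<nu> q \<bullet> D\<nu> q X + D\<nu> q X \<bullet> \<nu> q) = (\<lambda>X. 0)"
    by (rule has_derivative_unique)
  from fun_cong[OF this, of X] show ?thesis by (simp add: inner_commute)
qed

text \<open>The derivative of the identity \<open>\<langle>df(X), \<nu>\<rangle> = 0\<close> in the direction \<open>Y\<close>.\<close>

lemma second_fundamental_form:
  assumes q: "q \<in> U"
  shows "frechet_derivative (\<lambda>x. Df x X) (at q) Y \<bullet> \<nu> q = - (Df q X \<bullet> D\<nu> q Y)"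
proof -
  have "((\<lambda>x. Df x X) has_derivative frechet_derivative (\<lambda>x. Df x X) (at q)) (at q)"
    using smooth_on_Ck_on[OF smooth_on_directional[OF smooth_f]] Ck_on_has_derivative q by blast
  then have "((\<lambda>x. Df x X \<bullet> \<nu> x) has_derivative
      (\<lambda>Y. Df q X \<bullet> D\<nu> q Y + frechet_derivative (\<lambda>x. Df x X) (at q) Y \<bullet> \<nu> q)) (at q)"
    by (intro has_derivative_inner has_derivative_\<nu> q)
  moreover have "((\<lambda>x. Df x X \<bullet> \<nu> x) has_derivative (\<lambda>Y. 0)) (at q)"
    by (rule has_derivative_transform_within_open[OF has_derivative_const[of 0] U q])
      (use tangent_f in simp)
  ultimately have "(\<lambda>Y. Df q X \<bullet> D\<nu> q Y + frechet_derivative (\<lambda>x. Df x X) (at q) Y \<bullet> \<nu> q) = (\<lambda>Y. 0)"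
    by (rule has_derivative_unique)
  from fun_cong[OF this, of Y] show ?thesis by simp
qed

text \<open>Mixed second derivatives of \<open>f\<close> commute.\<close>

lemma second_fundamental_form_symmetric:
  assumes q: "q \<in> U"
  shows "Df q X \<bullet> D\<nu> q Y = Df q Y \<bullet> D\<nu> q X"
  using second_fundamental_form[OF q, of X Y] second_fundamental_form[OF q, of Y X]
    symmetric_second_derivative[OF U smooth_f q, of X Y] by simp

lemma first_fundamental_form_det:
  assumes q: "q \<in> U"
  shows "(D1 f q \<bullet> D1 f q) * (D2 f q \<bullet> D2 f q) - (D1 f q \<bullet> D2 f q)\<^sup>2 = (\<Lambda> q)\<^sup>2"
  using det3_gram[of "\<nu> q" "D1 f q" "D2 f q" "D1 f q" "D2 f q"] norm_\<nu>[OF q]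
    tangent_f[OF q, of "axis 1 1"] tangent_f[OF q, of "axis 2 1"]
  by (simp add: area_density_def D1_def D2_def dot_square_norm power2_eq_square inner_commute)

lemma mean_numerator_double:
  "2 * A q = - (det3 (D1 \<nu> q) (D2 f q) (\<nu> q) + det3 (D1 f q) (D2 \<nu> q) (\<nu> q))"
  by (simp add: mean_numerator_def field_simps)

text \<open>Both identities come from multiplying the numerators by \<open>\<Lambda>\<close>: the product of oriented areas
  is a Gram determinant, whose entries are coefficients of the two fundamental forms, and
  \<open>EG - F\<^sup>2 = \<Lambda>\<^sup>2\<close>.  Where \<open>\<Lambda>\<close> vanishes all the quotients are \<open>0\<close> by the convention on division.\<close>

lemma curvature_quotients:
  assumes q: "q \<in> U"
  shows mean_curvature_quotient: "mean_curvature f \<nu> q = A q / \<Lambda> q"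
    and gauss_curvature_quotient: "gauss_curvature f \<nu> q = B q / \<Lambda> q"
proof -
  let ?a = "D1 f q" and ?b = "D2 f q" and ?c = "D1 \<nu> q" and ?d = "D2 \<nu> q" and ?n = "\<nu> q"
  have tan: "?n \<bullet> ?n = 1" "?a \<bullet> ?n = 0" "?b \<bullet> ?n = 0" "?c \<bullet> ?n = 0" "?d \<bullet> ?n = 0"
    using norm_\<nu>[OF q] tangent_f[OF q] tangent_\<nu>[OF q] by (auto simp: D1_def D2_def dot_square_norm)
  have sym: "?a \<bullet> ?d = ?b \<bullet> ?c"
    using second_fundamental_form_symmetric[OF q] by (simp add: D1_def D2_def)
  have L: "D1 (D1 f) q \<bullet> ?n = - (?a \<bullet> ?c)" and M: "D2 (D1 f) q \<bullet> ?n = - (?a \<bullet> ?d)"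
    and N: "D2 (D2 f) q \<bullet> ?n = - (?b \<bullet> ?d)"
    using second_fundamental_form[OF q] by (simp_all add: D1_def[abs_def] D2_def[abs_def])
  note g = det3_gram[OF tan(1)] tan
  have 1: "(?a \<bullet> ?a) * - (?b \<bullet> ?d) - 2 * (?a \<bullet> ?b) * - (?a \<bullet> ?d) + (?b \<bullet> ?b) * - (?a \<bullet> ?c) = 2 * \<Lambda> q * A q"
  proof -
    have "\<Lambda> q * det3 ?a ?d ?n = (?a \<bullet> ?a) * (?b \<bullet> ?d) - (?a \<bullet> ?d) * (?b \<bullet> ?a)"
      unfolding area_density_def by (intro g)
    moreover have "\<Lambda> q * det3 ?c ?b ?n = (?a \<bullet> ?c) * (?b \<bullet> ?b) - (?a \<bullet> ?b) * (?b \<bullet> ?c)"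
      unfolding area_density_def by (intro g)
    moreover have "\<Lambda> q * (2 * A q) = - (\<Lambda> q * det3 ?c ?b ?n + \<Lambda> q * det3 ?a ?d ?n)"
      unfolding mean_numerator_double by (simp add: algebra_simps)
    ultimately show ?thesis using sym by (simp add: inner_commute algebra_simps)
  qed
  have 2: "(?a \<bullet> ?c) * (?b \<bullet> ?d) - (?a \<bullet> ?d)\<^sup>2 = \<Lambda> q * B q"
  proof -
    have "\<Lambda> q * B q = (?a \<bullet> ?c) * (?b \<bullet> ?d) - (?a \<bullet> ?d) * (?b \<bullet> ?c)"
      unfolding area_density_def gauss_numerator_def by (intro g)
    then show ?thesis using sym by (simp add: power2_eq_square)
  qed
  note EGF = first_fundamental_form_det[OF q]
  show "mean_curvature f \<nu> q = A q / \<Lambda> q"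
    unfolding mean_curvature_def Let_def L M N EGF 1 by (simp add: power2_eq_square)
  show "gauss_curvature f \<nu> q = B q / \<Lambda> q"
    using 2 unfolding gauss_curvature_def Let_def L M N EGF by (simp add: power2_eq_square)
qed

text \<open>The partial derivatives of \<open>f\<close> are linearly dependent exactly where they span no area in the
  tangent plane.  In that case \<open>(\<langle>f\<^sub>u, f\<^sub>v\<rangle>, -\<langle>f\<^sub>u, f\<^sub>u\<rangle>)\<close> is a null vector unless \<open>f\<^sub>u = 0\<close>.\<close>

lemma sing_set_iff:
  assumes q: "q \<in> U"
  shows "q \<in> sing_set U f \<longleftrightarrow> \<Lambda> q = 0"
proof -
  let ?a = "D1 f q" and ?b = "D2 f q"
  have lin: "linear (Df q)" using has_derivative_linear[OF has_derivative_f[OF q]] .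
  have "X = 0" if "\<Lambda> q \<noteq> 0" "Df q X = 0" for X
  proof -
    have "X$1 * \<Lambda> q = det3 (Df q X) ?b (\<nu> q)" "X$2 * \<Lambda> q = det3 ?a (Df q X) (\<nu> q)"
      by (simp_all add: Df_expand[OF q] area_density_def det3_def det_3 algebra_simps)
    then show ?thesis using that by (simp add: det3_def det_3 vec_eq_iff forall_2)
  qed
  moreover have "\<exists>X. X \<noteq> 0 \<and> Df q X = 0" if "\<Lambda> q = 0"
  proof (cases "?a = 0")
    case True
    then show ?thesis by (intro exI[of _ "axis 1 1"]) (simp add: D1_def axis_eq_0_iff)
  next
    case False
    let ?X = "(?a \<bullet> ?b) *\<^sub>R axis 1 1 - (?a \<bullet> ?a) *\<^sub>R axis 2 1 :: real^2"
    have X: "?X $ 1 = ?a \<bullet> ?b" "?X $ 2 = - (?a \<bullet> ?a)" by (simp_all add: axis_def)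
    then have "Df q ?X \<bullet> Df q ?X = (?a \<bullet> ?a) * ((?a \<bullet> ?a) * (?b \<bullet> ?b) - (?a \<bullet> ?b)\<^sup>2)"
      unfolding Df_expand[OF q] X
      by (simp add: inner_add_left inner_add_right inner_commute power2_eq_square algebra_simps)
    then have "Df q ?X = 0" using first_fundamental_form_det[OF q] that by simp
    moreover have "?X \<noteq> 0" using X(2) False by (metis inner_eq_zero_iff neg_equal_0_iff_equal zero_index)
    ultimately show ?thesis by blast
  qed
  ultimately show ?thesis using q linear_injective_0[OF lin] by (auto simp: sing_set_def)
qed

text \<open>The numerators can be computed in any frame \<open>X, Y\<close> instead of the coordinate frame; on the
  singular set a null vector is then used as one member of the frame.\<close>

lemma mean_numerator_area2:
  assumes q: "q \<in> U"
  shows "area2 X Y * (2 * A q) = - (det3 (D\<nu> q X) (Df q Y) (\<nu> q) + det3 (Df q X) (D\<nu> q Y) (\<nu> q))"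
  unfolding mean_numerator_double Df_expand[OF q] D\<nu>_expand[OF q] det3_combination
  by (simp add: area2_def det3_swap'[of "D2 f q" "D1 \<nu> q"]
      det3_swap'[of "D2 \<nu> q" "D1 f q"] det3_swap'[of "D1 f q" "D1 \<nu> q"]
      det3_swap'[of "D2 f q" "D2 \<nu> q"] algebra_simps)

lemma gauss_numerator_area2:
  assumes q: "q \<in> U"
  shows "area2 X Y * B q = det3 (D\<nu> q X) (D\<nu> q Y) (\<nu> q)"
  unfolding D\<nu>_expand[OF q] det3_combination
  by (simp add: gauss_numerator_def area2_def det3_swap'[of "D2 \<nu> q" "D1 \<nu> q"] algebra_simps)
    (simp add: det3_def det_3)

text \<open>Taking \<open>X\<close> to be the velocity of the singular curve and \<open>Y\<close> a null vector, the right-hand side is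
  the function \<open>\<psi>\<close> that measures the failure of \<open>f\<close> to be a front.\<close>

lemma mean_numerator_null:
  assumes q: "q \<in> U" and null: "Df q Y = 0"
  shows "area2 X Y * (2 * A q) = det3 (Df q X) (\<nu> q) (D\<nu> q Y)"
  using mean_numerator_area2[OF q, of X Y] null
  by (simp add: det3_swap[of _ "\<nu> q"]) (simp add: det3_def det_3)

text \<open>On the singular curve, and for \<open>X\<close> its velocity, this is the limiting normal curvature.\<close>

definition normal_curvature :: "real^2 \<Rightarrow> real^2 \<Rightarrow> real" where
  "normal_curvature X q = - (Df q X \<bullet> D\<nu> q X) / (Df q X \<bullet> Df q X)"

text \<open>By the symmetry of the second fundamental form, the derivative of \<open>\<nu>\<close> in the null direction
  \<open>Y\<close> is orthogonal to \<open>df(X)\<close>.  So its direction in the tangent plane is known, and only its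
  length, which is \<open>A\<close> up to a factor, enters \<open>B\<close>.  Hence \<open>B\<close> vanishes to at least the
  order of \<open>A\<close> along the singular curve.\<close>

lemma gauss_numerator_null:
  assumes q: "q \<in> U" and null: "Df q Y = 0" and "area2 X Y \<noteq> 0" "Df q X \<noteq> 0"
  shows "B q = 2 * normal_curvature X q * A q"
proof -
  let ?a = "Df q X" and ?c = "D\<nu> q X" and ?d = "D\<nu> q Y" and ?n = "\<nu> q"
  have "?a \<bullet> ?d = 0" using second_fundamental_form_symmetric[OF q, of X Y] null by simp
  then have "(?a \<bullet> ?a) * det3 ?c ?d ?n = (?a \<bullet> ?c) * det3 ?a ?d ?n"
    using det3_linear_dependency[of ?a ?c ?d ?n] tangent_f[OF q, of X] by simp
  then have "(?a \<bullet> ?a) * (area2 X Y * B q) = (?a \<bullet> ?c) * - (area2 X Y * (2 * A q))"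
    unfolding mean_numerator_null[OF q null] gauss_numerator_area2[OF q] by (simp add: det3_swap[of _ ?n])
  then have "area2 X Y * ((?a \<bullet> ?a) * B q) = area2 X Y * (- 2 * (?a \<bullet> ?c) * A q)"
    by (simp add: algebra_simps)
  then have "(?a \<bullet> ?a) * B q = - 2 * (?a \<bullet> ?c) * A q" using assms(3) by (metis mult_left_cancel)
  then show ?thesis using assms(4) by (simp add: normal_curvature_def field_simps)
qed

end

section \<open>Extension and blow-up of the principal curvatures\<close>

text \<open>The estimate behind the boundedness of the continuous branch at the point \<open>p\<close> itself, where
  \<open>A\<close>, \<open>B\<close> and \<open>l\<close> vanish simultaneously.  Up to \<open>O(l\<^sup>2)\<close>, the radicand is \<open>(A - \<kappa>l)\<^sup>2\<close>, so its root differs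
  from \<open>\<bar>A\<bar>\<close> by \<open>O(l)\<close>; and \<open>s A\<close> is \<open>-\<bar>A\<bar>\<close> up to \<open>O(l)\<close>, so the two cancel.  The proof allows a negative radicand,
  whose \<open>sqrt\<close> is minus the root of its absolute value.\<close>

lemma quadratic_root_bounded:
  fixes A B C l \<kappa> s :: real
  assumes s: "s \<in> {1, -1}" and l: "l \<noteq> 0" and B: "\<bar>B - 2 * \<kappa> * A\<bar> \<le> C * \<bar>l\<bar>"
    and \<kappa>: "\<bar>\<kappa>\<bar> \<le> C" and A: "s * A \<le> C * \<bar>l\<bar>"
  shows "\<bar>(A + s * sqrt (A\<^sup>2 - l * B)) / l\<bar> \<le> 10 * C + 4"
proof -
  define x where "x = A\<^sup>2 - l * B"
  define a where "a = \<bar>A\<bar>"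
  define m where "m = (2 * C + 1) * \<bar>l\<bar>"
  have C: "C \<ge> 0" using \<kappa> by linarith
  have m: "m \<ge> 0" using C by (simp add: m_def)
  have a: "a \<ge> 0" "a\<^sup>2 = A\<^sup>2" by (simp_all add: a_def)
  have "\<bar>B\<bar> \<le> \<bar>2 * \<kappa> * A\<bar> + C * \<bar>l\<bar>" using B by linarith
  also have "\<bar>2 * \<kappa> * A\<bar> \<le> 2 * C * a"
    using mult_right_mono[OF \<kappa> a(1)] by (simp add: a_def abs_mult)
  finally have "\<bar>l\<bar> * \<bar>B\<bar> \<le> \<bar>l\<bar> * (2 * C * a + C * \<bar>l\<bar>)" by (intro mult_left_mono) auto
  then have lB: "\<bar>l * B\<bar> \<le> 2 * C * a * \<bar>l\<bar> + C * \<bar>l\<bar>\<^sup>2"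
    by (simp add: abs_mult algebra_simps power2_eq_square)
  have C2: "2 * C * a * \<bar>l\<bar> + C * \<bar>l\<bar>\<^sup>2 + (a * \<bar>l\<bar> + (4 * C\<^sup>2 + 3 * C + 1) * \<bar>l\<bar>\<^sup>2) = a * m + m\<^sup>2"
    by (simp add: m_def power2_eq_square algebra_simps)
  have "0 \<le> a * \<bar>l\<bar> + (4 * C\<^sup>2 + 3 * C + 1) * \<bar>l\<bar>\<^sup>2" using a C by simp
  then have lB': "\<bar>l * B\<bar> \<le> a * m + m\<^sup>2" using lB C2 by linarith
  have up: "sqrt x \<le> a + m"
  proof (rule real_le_lsqrt)
    have "x \<le> a\<^sup>2 + (a * m + m\<^sup>2)" using lB' a unfolding x_def by linarith
    also have "\<dots> \<le> (a + m)\<^sup>2" using a m by (simp add: power2_eq_square algebra_simps)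
    finally show "x \<le> (a + m)\<^sup>2" .
  qed (use a m in auto)
  \<comment> \<open>The first case, in which \<open>a\<close> is itself of order \<open>l\<close>, includes that of a negative radicand.\<close>
  have low: "a - 4 * m \<le> sqrt x"
  proof (cases "a \<le> 2 * m")
    case True
    have "a * m \<le> 2 * m * m" using True m by (intro mult_right_mono) auto
    then have "- ((2 * m)\<^sup>2) \<le> x"
      using lB' zero_le_power2[of A] zero_le_power2[of m]
      unfolding x_def power_mult_distrib power2_eq_square by linarith
    then have "sqrt (- ((2 * m)\<^sup>2)) \<le> sqrt x" by (rule real_sqrt_le_mono)
    moreover have "sqrt (- ((2 * m)\<^sup>2)) = - (2 * m)"
      using m unfolding real_sqrt_minus real_sqrt_abs by simp
    ultimately show ?thesis using True by linarith
  next
    case False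
    have "a - 2 * m \<le> sqrt x"
    proof (rule real_le_rsqrt)
      have "(a - 2 * m)\<^sup>2 = a\<^sup>2 - 4 * (a * m) + 4 * m\<^sup>2" by (simp add: power2_eq_square algebra_simps)
      moreover have "2 * m * m \<le> a * m" using False m by (intro mult_right_mono) auto
      ultimately have "(a - 2 * m)\<^sup>2 \<le> a\<^sup>2 - (a * m + m\<^sup>2)"
        using zero_le_power2[of m] unfolding power2_eq_square by linarith
      also have "\<dots> \<le> x" using lB' a unfolding x_def by linarith
      finally show "(a - 2 * m)\<^sup>2 \<le> x" .
    qed
    then show ?thesis using m by linarith
  qed
  have "C * \<bar>l\<bar> \<ge> 0" using C by simp
  then have "s * A + a \<le> 2 * (C * \<bar>l\<bar>)" "0 \<le> s * A + a"
    using s A by (auto simp: a_def)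
  then have "\<bar>s * A + sqrt x\<bar> \<le> (10 * C + 4) * \<bar>l\<bar>"
    using up low m unfolding m_def by (simp add: algebra_simps abs_le_iff)
  moreover have "\<bar>s * A + sqrt x\<bar> = \<bar>A + s * sqrt x\<bar>"
    using s by (auto simp: abs_if)
  ultimately show ?thesis using l by (simp add: x_def abs_divide pos_divide_le_eq)
qed

context frontal_surface
begin

lemma principal_curvature_quotient:
  assumes q: "q \<in> U"
  shows "principal_curvature s f \<nu> q = (A q + s * sqrt ((A q)\<^sup>2 - \<Lambda> q * B q)) / \<Lambda> q"
proof (cases "\<Lambda> q = 0")
  case True
  then show ?thesis
    by (simp add: principal_curvature_def curvature_quotients[OF q] root_H2_K_def)
next
  case False
  have "(A q / \<Lambda> q)\<^sup>2 - B q / \<Lambda> q = ((A q)\<^sup>2 - \<Lambda> q * B q) / (\<Lambda> q)\<^sup>2"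
    using False by (simp add: field_simps power2_eq_square)
  then have "root_H2_K f \<nu> q = sqrt ((A q)\<^sup>2 - \<Lambda> q * B q) / \<Lambda> q"
    unfolding root_H2_K_def curvature_quotients[OF q]
    using False by (simp add: real_sqrt_divide sgn_real_def)
  then show ?thesis
    unfolding principal_curvature_def curvature_quotients[OF q] by (simp add: add_divide_distrib)
qed

lemma isCont_numerators:
  assumes q: "q \<in> U"
  shows "isCont \<Lambda> q" "isCont A q" "isCont B q"
  using q U Ck_on_imp_continuous_on[OF Ck_on_area_density] Ck_on_imp_continuous_on[OF Ck_on_mean_numerator]
    Ck_on_imp_continuous_on[OF Ck_on_gauss_numerator] continuous_on_eq_continuous_at by blast+

text \<open>The value on the singular set is that of \<open>B / (A - s \<surd>(A\<^sup>2 - \<Lambda>B))\<close>, the other form of the curvature,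
  in the case \<open>s A < 0\<close>.\<close>

definition extension :: "real \<Rightarrow> real^2 \<Rightarrow> real" where
  "extension s q = (if \<Lambda> q = 0 then B q / (2 * A q) else principal_curvature s f \<nu> q)"

lemma isCont_extension_regular:
  assumes q: "q \<in> U" "\<Lambda> q \<noteq> 0"
  shows "isCont (extension s) q"
proof (rule isCont_cong_near)
  have "open (U \<inter> \<Lambda> -` (- {0}))"
    by (rule continuous_open_preimage[OF Ck_on_imp_continuous_on[OF Ck_on_area_density] U]) auto
  then show "open (U \<inter> \<Lambda> -` (- {0}))" .
  show "q \<in> U \<inter> \<Lambda> -` (- {0})" using q by simp
  show "isCont (\<lambda>q. (A q + s * sqrt ((A q)\<^sup>2 - \<Lambda> q * B q)) / \<Lambda> q) q"
    using q by (intro continuous_intros isCont_numerators) auto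
qed (simp add: extension_def principal_curvature_quotient)

text \<open>Since \<open>(A + s \<surd>x)(A - s \<surd>x) = \<Lambda>B\<close> for \<open>x = A\<^sup>2 - \<Lambda>B\<close>, the curvature is also
  \<open>B / (A - s \<surd>x)\<close>.  If \<open>s\<close> is opposite to the sign of \<open>A\<close>, then nothing cancels in this
  denominator, which tends to \<open>2A\<close> on the singular set.\<close>

lemma isCont_extension_singular:
  assumes q: "q \<in> U" "\<Lambda> q = 0" and s: "s \<in> {1, -1}" "s * A q < 0"
  shows "isCont (extension s) q"
proof (rule isCont_cong_near)
  let ?x = "\<lambda>q. (A q)\<^sup>2 - \<Lambda> q * B q"
  let ?V = "{y \<in> U. s * A y < 0} \<inter> {y \<in> U. ?x y > 0}"
  have c: "continuous_on U A" "continuous_on U B" "continuous_on U \<Lambda>"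
    using Ck_on_imp_continuous_on Ck_on_mean_numerator Ck_on_gauss_numerator Ck_on_area_density by blast+
  have "open {y \<in> U. s * A y < 0}"
    using continuous_open_preimage[OF _ U open_lessThan[of 0], of "\<lambda>y. s * A y"] c
    by (simp add: vimage_def Int_def continuous_on_mult_left)
  moreover have "continuous_on U ?x" by (intro continuous_intros c)
  then have "open {y \<in> U. ?x y > 0}"
    using continuous_open_preimage[OF _ U open_greaterThan[of 0], of ?x]
    by (simp add: vimage_def Int_def)
  ultimately show "open ?V" by (rule open_Int)
  show "q \<in> ?V" using q s by auto
  have root: "s * A y - sqrt (?x y) < 0" if "y \<in> ?V" for y using that
    by (smt (verit) IntE mem_Collect_eq real_sqrt_gt_zero)
  have sq: "A y - s * sqrt (?x y) = s * (s * A y - sqrt (?x y))" for y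
    using s by auto
  have nz: "A y - s * sqrt (?x y) \<noteq> 0" if "y \<in> ?V" for y
    unfolding sq using root[OF that] s by auto
  show "isCont (\<lambda>y. B y / (A y - s * sqrt (?x y))) q"
    using nz[OF \<open>q \<in> ?V\<close>] q by (intro continuous_intros isCont_numerators) auto
  fix y assume y: "y \<in> ?V"
  show "B y / (A y - s * sqrt (?x y)) = extension s y"
  proof (cases "\<Lambda> y = 0")
    case True
    have "A y - s * sqrt (?x y) = 2 * A y" using y s True by auto
    then show ?thesis using True by (simp add: extension_def)
  next
    case False
    have "(A y + s * sqrt (?x y)) * (A y - s * sqrt (?x y)) = (A y)\<^sup>2 - s\<^sup>2 * (sqrt (?x y))\<^sup>2"
      by (simp add: power2_eq_square algebra_simps)
    also have "\<dots> = \<Lambda> y * B y" using y s by auto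
    finally have "(A y + s * sqrt (?x y)) / \<Lambda> y = B y / (A y - s * sqrt (?x y))"
      using False nz[OF y] by (simp add: frac_eq_eq mult.commute)
    then show ?thesis using False y by (simp add: extension_def principal_curvature_quotient)
  qed
qed

text \<open>If \<open>s\<close> is the sign of \<open>A\<close>, then the numerator of the curvature tends to \<open>2A \<noteq> 0\<close>, while the
  denominator \<open>\<Lambda>\<close> tends to \<open>0\<close>.\<close>

lemma unbounded_near_singular:
  assumes q: "q \<in> U" and s: "s \<in> {1, -1}" "s * A q > 0"
    and sing: "\<Lambda> q = 0" and lim: "\<And>V. open V \<Longrightarrow> q \<in> V \<Longrightarrow> \<exists>x\<in>V \<inter> U. \<Lambda> x \<noteq> 0"
  shows "unbounded_near U (sing_set U f) (principal_curvature s f \<nu>) q"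
  unfolding unbounded_near_def
proof (intro allI impI notI)
  fix V assume V: "open V" "q \<in> V"
    and "bounded (principal_curvature s f \<nu> ` (V \<inter> (U - sing_set U f)))"
  then obtain M where M: "\<And>y. y \<in> V \<inter> U \<Longrightarrow> \<Lambda> y \<noteq> 0 \<Longrightarrow> \<bar>principal_curvature s f \<nu> y\<bar> \<le> M"
    unfolding bounded_iff using sing_set_iff by auto
  let ?x = "\<lambda>q. (A q)\<^sup>2 - \<Lambda> q * B q"
  define F where "F y = \<bar>A y + s * sqrt (?x y)\<bar> - M * \<bar>\<Lambda> y\<bar>" for y
  have "continuous_on U A" "continuous_on U B" "continuous_on U \<Lambda>"
    using Ck_on_imp_continuous_on Ck_on_mean_numerator Ck_on_gauss_numerator Ck_on_area_density by blast+
  then have "continuous_on U F" unfolding F_def[abs_def] by (intro continuous_intros)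
  then have "open (U \<inter> F -` {0<..})" by (rule continuous_open_preimage[OF _ U open_greaterThan])
  moreover have "F q > 0" using s sing by (auto simp: F_def)
  ultimately obtain y where y: "y \<in> V \<inter> U" "F y > 0" "\<Lambda> y \<noteq> 0"
    using lim[of "V \<inter> (U \<inter> F -` {0<..})"] V q by auto
  then have "\<bar>A y + s * sqrt (?x y)\<bar> \<le> M * \<bar>\<Lambda> y\<bar>"
    using M[of y] by (simp add: principal_curvature_quotient abs_divide pos_divide_le_eq)
  then show False using y(2) by (simp add: F_def)
qed

end

section \<open>The geometry near a singular point of the first kind\<close>

lemma bounded_bilinear_area2: "bounded_bilinear area2"
  unfolding bilinear_conv_bounded_bilinear[symmetric] bilinear_def area2_def
  by (auto intro!: linearI simp: algebra_simps)

lemma has_vector_derivative_velocity: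
  fixes c :: "real \<Rightarrow> 'a::real_normed_vector"
  assumes "smooth_on c S" "t \<in> S"
  shows "(c has_vector_derivative velocity c t) (at t)"
  using smooth_on_Ck_on[OF assms(1), of 1] assms(2)
  by (simp add: velocity_def vector_derivative_works[symmetric])

lemma Ck_on_velocity:
  fixes c :: "real \<Rightarrow> 'a::real_normed_vector"
  assumes "smooth_on c S" "open S"
  shows "Ck_on k (velocity c) S"
proof (rule Ck_on_cong[OF assms(2)])
  show "Ck_on k (\<lambda>t. frechet_derivative c (at t) 1) S"
    using smooth_on_Ck_on[OF smooth_on_directional[OF assms(1)]] .
  show "frechet_derivative c (at t) 1 = velocity c t" if "t \<in> S" for t
    using frechet_derivative_at[OF has_vector_derivative_velocity[OF assms(1) that, unfolded has_vector_derivative_def]]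
    by (metis scaleR_one)
qed

locale first_kind_point = frontal_surface +
  fixes p :: "real^2" and \<epsilon> :: real and \<gamma> :: "real \<Rightarrow> real^2" and \<eta> :: "real^2 \<Rightarrow> real^2"
  assumes first_kind: "first_kind U f \<nu> p \<epsilon> \<gamma> \<eta>"
begin

abbreviation "T \<equiv> velocity \<gamma> 0"
abbreviation "D\<Lambda> q X \<equiv> frechet_derivative \<Lambda> (at q) X"

lemma \<epsilon>: "\<epsilon> > 0" and smooth_\<gamma>: "smooth_on \<gamma> {-\<epsilon><..<\<epsilon>}" and T_nonzero: "T \<noteq> 0"
  and inj_\<gamma>: "inj_on \<gamma> {-\<epsilon><..<\<epsilon>}" and \<gamma>0: "\<gamma> 0 = p"
  using first_kind by (auto simp: first_kind_def singular_curve_def)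

lemma \<gamma>_singular: "\<bar>t\<bar> < \<epsilon> \<Longrightarrow> \<gamma> t \<in> sing_set U f"
  using first_kind by (force simp: first_kind_def singular_curve_def abs_less_iff)

lemma \<gamma>_in_U: "\<bar>t\<bar> < \<epsilon> \<Longrightarrow> \<gamma> t \<in> U"
  using \<gamma>_singular by (auto simp: sing_set_def)

lemma \<Lambda>_\<gamma>: "\<bar>t\<bar> < \<epsilon> \<Longrightarrow> \<Lambda> (\<gamma> t) = 0"
  using \<gamma>_singular \<gamma>_in_U sing_set_iff by blast

lemma p_in_U: "p \<in> U" using \<gamma>_in_U[of 0] \<epsilon> \<gamma>0 by simp

lemma \<gamma>_derivative: "\<bar>t\<bar> < \<epsilon> \<Longrightarrow> (\<gamma> has_vector_derivative velocity \<gamma> t) (at t)"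
  by (rule has_vector_derivative_velocity[OF smooth_\<gamma>]) auto

lemma isCont_\<gamma>: "\<bar>t\<bar> < \<epsilon> \<Longrightarrow> isCont \<gamma> t"
  using \<gamma>_derivative has_vector_derivative_continuous by blast

lemma has_derivative_\<Lambda>: "q \<in> U \<Longrightarrow> (\<Lambda> has_derivative D\<Lambda> q) (at q)"
  using Ck_on_has_derivative[OF Ck_on_area_density] by blast

definition curve_normal :: "real^2" where
  "curve_normal = (- T $ 2) *\<^sub>R axis 1 1 + (T $ 1) *\<^sub>R axis 2 1"

lemma curve_normal_components: "curve_normal $ 1 = - T $ 2" "curve_normal $ 2 = T $ 1"
  by (simp_all add: curve_normal_def axis_def)

lemma curve_normal_nonzero: "curve_normal \<noteq> 0"
  using T_nonzero curve_normal_components by (auto simp: vec_eq_iff forall_2)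

lemma orthogonal_decomposition: "(T \<bullet> T) *\<^sub>R X = (X \<bullet> T) *\<^sub>R T + (X \<bullet> curve_normal) *\<^sub>R curve_normal"
  by (simp add: vec_eq_iff forall_2 inner_vec_def sum_2 curve_normal_components algebra_simps)

text \<open>The area density vanishes along \<open>\<gamma>\<close>; so non-degeneracy is a statement about the direction
  normal to \<open>\<gamma>\<close>.\<close>

lemma D\<Lambda>_T: "D\<Lambda> p T = 0"
proof -
  have "((\<Lambda> \<circ> \<gamma>) has_derivative (\<lambda>h. D\<Lambda> p (h *\<^sub>R T))) (at 0)"
    using diff_chain_at[of \<gamma> "\<lambda>h. h *\<^sub>R T" 0 \<Lambda> "D\<Lambda> p"] \<gamma>_derivative[of 0] \<epsilon> \<gamma>0
      has_derivative_\<Lambda>[OF p_in_U] by (simp add: has_vector_derivative_def o_def)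
  moreover have "((\<Lambda> \<circ> \<gamma>) has_derivative (\<lambda>h. 0)) (at 0)"
    by (rule has_derivative_transform_within_open[OF has_derivative_const[of 0] open_greaterThanLessThan[of "-\<epsilon>" \<epsilon>]])
      (use \<epsilon> \<Lambda>_\<gamma> in \<open>auto simp: abs_less_iff\<close>)
  ultimately have "(\<lambda>h. D\<Lambda> p (h *\<^sub>R T)) = (\<lambda>h. 0)" by (rule has_derivative_unique)
  from fun_cong[OF this, of 1] show ?thesis by simp
qed

lemma D\<Lambda>_curve_normal: "D\<Lambda> p curve_normal \<noteq> 0"
proof
  assume *: "D\<Lambda> p curve_normal = 0"
  have lin: "linear (D\<Lambda> p)" by (rule has_derivative_linear[OF has_derivative_\<Lambda>[OF p_in_U]])
  have "D\<Lambda> p X = 0" for X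
  proof -
    have "(T \<bullet> T) * D\<Lambda> p X = D\<Lambda> p ((T \<bullet> T) *\<^sub>R X)" by (simp add: linear_scale[OF lin])
    also have "\<dots> = 0"
      unfolding orthogonal_decomposition by (simp add: linear_add[OF lin] linear_scale[OF lin] D\<Lambda>_T *)
    finally show ?thesis using T_nonzero by simp
  qed
  then show False using first_kind by (auto simp: first_kind_def nondegenerate_sing_pt_def)
qed

text \<open>By the mean value theorem on the segment from \<open>y\<close> to \<open>x\<close>, which is parallel to the normal of
  \<open>\<gamma>\<close> at \<open>p\<close>.  This estimate replaces the inverse function theorem: it shows at once that the
  singular set near \<open>p\<close> is covered by \<open>\<gamma>\<close>, that it has no interior, and that \<open>\<bar>\<Lambda>\<bar>\<close> controls the
  distance from it.\<close>

lemma area_density_transversal_growth: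
  "\<exists>R>0. \<exists>c>0. ball p R \<subseteq> U \<and>
    (\<forall>x\<in>ball p R. \<forall>y\<in>ball p R. (x - y) \<bullet> T = 0 \<longrightarrow> c * norm (x - y) \<le> \<bar>\<Lambda> x - \<Lambda> y\<bar>)"
proof -
  define d where "d = \<bar>D\<Lambda> p curve_normal\<bar> / 2"
  have d: "d > 0" using D\<Lambda>_curve_normal by (simp add: d_def)
  have "continuous_on U (\<lambda>q. D\<Lambda> q curve_normal)"
    using Ck_on_area_density[of "Suc 0"] by simp
  then have "isCont (\<lambda>q. D\<Lambda> q curve_normal) p"
    using U p_in_U continuous_on_eq_continuous_at by blast
  then have "\<forall>\<^sub>F q in nhds p. dist (D\<Lambda> q curve_normal) (D\<Lambda> p curve_normal) < d"
    using d by (intro tendstoD[OF isCont_tendsto_nhds])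
  then have "\<forall>\<^sub>F q in nhds p. q \<in> U \<and> dist (D\<Lambda> q curve_normal) (D\<Lambda> p curve_normal) < d"
    using eventually_nhds_in_open[OF U p_in_U] by (intro eventually_conj)
  then obtain R where R: "R > 0" "\<And>q. dist q p < R \<Longrightarrow> q \<in> U \<and> dist (D\<Lambda> q curve_normal) (D\<Lambda> p curve_normal) < d"
    unfolding eventually_nhds_metric by blast
  have big: "\<bar>D\<Lambda> q curve_normal\<bar> \<ge> d" and inU: "q \<in> U" if "q \<in> ball p R" for q
    using R(2)[of q] that abs_triangle_ineq2_sym[of "D\<Lambda> p curve_normal" "D\<Lambda> q curve_normal"]
    unfolding d_def dist_real_def by (simp_all add: dist_commute)
  have "d / norm curve_normal * norm (x - y) \<le> \<bar>\<Lambda> x - \<Lambda> y\<bar>"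
    if x: "x \<in> ball p R" and y: "y \<in> ball p R" and perp: "(x - y) \<bullet> T = 0" for x y
  proof -
    define r where "r = ((x - y) \<bullet> curve_normal) / (T \<bullet> T)"
    have xy: "x - y = r *\<^sub>R curve_normal"
    proof -
      have "(T \<bullet> T) *\<^sub>R (x - y) = (T \<bullet> T) *\<^sub>R (r *\<^sub>R curve_normal)"
        unfolding orthogonal_decomposition[of "x - y"] perp using T_nonzero by (simp add: r_def)
      then show ?thesis using T_nonzero unfolding scaleR_cancel_left by simp
    qed
    have seg: "y + s *\<^sub>R (x - y) \<in> ball p R" if "0 \<le> s" "s \<le> 1" for s
    proof -
      have "y + s *\<^sub>R (x - y) = (1 - s) *\<^sub>R y + s *\<^sub>R x" by (simp add: algebra_simps)
      then show ?thesis using convexD_alt[OF convex_ball y x that] by simp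
    qed
    have der: "((\<lambda>s. \<Lambda> (y + s *\<^sub>R (x - y))) has_field_derivative D\<Lambda> (y + s *\<^sub>R (x - y)) (x - y)) (at s)"
      if "0 \<le> s" "s \<le> 1" for s
      by (rule DERIV_along_line)
        (use has_derivative_\<Lambda>[OF inU[OF seg[OF that]]] in \<open>auto simp: differentiable_def\<close>)
    obtain s where s: "0 < s" "s < 1"
      "\<Lambda> (y + 1 *\<^sub>R (x - y)) - \<Lambda> (y + 0 *\<^sub>R (x - y)) = (1 - 0) * D\<Lambda> (y + s *\<^sub>R (x - y)) (x - y)"
      using MVT2[OF zero_less_one der] by blast
    let ?z = "y + s *\<^sub>R (x - y)"
    have z: "?z \<in> ball p R" using seg s by simp
    have "\<Lambda> x - \<Lambda> y = r * D\<Lambda> ?z curve_normal"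
      using s(3) linear_scale[OF has_derivative_linear[OF has_derivative_\<Lambda>[OF inU[OF z]]], of r curve_normal]
      by (simp add: xy[symmetric])
    then have "\<bar>\<Lambda> x - \<Lambda> y\<bar> = \<bar>r\<bar> * \<bar>D\<Lambda> ?z curve_normal\<bar>" by (simp add: abs_mult)
    moreover have "\<bar>r\<bar> * d \<le> \<bar>r\<bar> * \<bar>D\<Lambda> ?z curve_normal\<bar>" by (intro mult_left_mono big z) auto
    ultimately show ?thesis using curve_normal_nonzero by (simp add: xy mult.commute)
  qed
  moreover have "d / norm curve_normal > 0" using d curve_normal_nonzero by simp
  moreover have "ball p R \<subseteq> U" using inU by blast
  ultimately show ?thesis using R(1) by blast
qed

lemma regular_points_dense:
  "\<exists>R>0. ball p R \<subseteq> U \<and>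
    (\<forall>q\<in>ball p R. \<forall>V. \<Lambda> q = 0 \<longrightarrow> open V \<longrightarrow> q \<in> V \<longrightarrow> (\<exists>x\<in>V \<inter> U. \<Lambda> x \<noteq> 0))"
proof -
  obtain R c where R: "R > 0" "c > 0" "ball p R \<subseteq> U"
    "\<And>x y. x \<in> ball p R \<Longrightarrow> y \<in> ball p R \<Longrightarrow> (x - y) \<bullet> T = 0 \<Longrightarrow> c * norm (x - y) \<le> \<bar>\<Lambda> x - \<Lambda> y\<bar>"
    using area_density_transversal_growth by blast
  have "\<exists>x\<in>V \<inter> U. \<Lambda> x \<noteq> 0" if q: "q \<in> ball p R" "\<Lambda> q = 0" and V: "open V" "q \<in> V" for q V
  proof -
    have "open (V \<inter> ball p R)" using V by auto
    then obtain e where e: "e > 0" "ball q e \<subseteq> V \<inter> ball p R"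
      using V q open_contains_ball by blast
    define x where "x = q + (e / 2 / norm curve_normal) *\<^sub>R curve_normal"
    have nx: "norm (x - q) = e / 2" using e curve_normal_nonzero by (simp add: x_def)
    have "dist q x = e / 2" using nx by (simp add: dist_norm norm_minus_commute)
    then have "x \<in> ball q e" using e by simp
    then have x: "x \<in> V \<inter> ball p R" using e(2) by blast
    have "(x - q) \<bullet> T = 0"
      by (simp add: x_def inner_vec_def sum_2 curve_normal_components)
    then have "c * norm (x - q) \<le> \<bar>\<Lambda> x - \<Lambda> q\<bar>" using R(4) x q by blast
    moreover have "c * norm (x - q) > 0" using R(2) e(1) unfolding nx by simp
    ultimately have "\<Lambda> x \<noteq> 0" using q by auto
    then show ?thesis using x R(3) by blast
  qed
  then show ?thesis using R(1,3) by blast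
qed

text \<open>The intermediate value theorem, applied to the component of \<open>\<gamma>\<close> along its velocity at \<open>p\<close>,
  yields a point \<open>\<gamma> t\<close> on the normal line through \<open>q\<close>; then the transversal growth of \<open>\<Lambda>\<close>
  applies.  In particular a singular point \<open>q\<close> is equal to \<open>\<gamma> t\<close>, with \<open>t\<close> as small as desired.\<close>

lemma distance_to_singular_curve:
  "\<exists>C\<ge>0. \<forall>\<delta>>0. \<exists>R>0. ball p R \<subseteq> U \<and>
    (\<forall>q\<in>ball p R. \<exists>t. \<bar>t\<bar> < \<delta> \<and> \<bar>t\<bar> < \<epsilon> \<and> norm (q - \<gamma> t) \<le> C * \<bar>\<Lambda> q\<bar>)"
proof -
  obtain R0 c where R0: "R0 > 0" "c > 0" "ball p R0 \<subseteq> U"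
    "\<And>x y. x \<in> ball p R0 \<Longrightarrow> y \<in> ball p R0 \<Longrightarrow> (x - y) \<bullet> T = 0 \<Longrightarrow> c * norm (x - y) \<le> \<bar>\<Lambda> x - \<Lambda> y\<bar>"
    using area_density_transversal_growth by blast
  have "\<exists>R>0. ball p R \<subseteq> U \<and>
    (\<forall>q\<in>ball p R. \<exists>t. \<bar>t\<bar> < \<delta> \<and> \<bar>t\<bar> < \<epsilon> \<and> norm (q - \<gamma> t) \<le> 1 / c * \<bar>\<Lambda> q\<bar>)" if \<delta>: "\<delta> > 0" for \<delta>
  proof -
    have "\<forall>\<^sub>F t in nhds 0. dist (\<gamma> t) (\<gamma> 0) < R0"
      using R0(1) isCont_\<gamma>[of 0] \<epsilon> by (intro tendstoD[OF isCont_tendsto_nhds]) auto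
    then obtain d1 where d1: "d1 > 0" "\<And>t. \<bar>t\<bar> < d1 \<Longrightarrow> \<gamma> t \<in> ball p R0"
      unfolding eventually_nhds_metric by (auto simp: \<gamma>0 dist_commute)
    define h where "h t = (\<gamma> t - p) \<bullet> T" for t
    have "(h has_derivative (\<lambda>s. (s *\<^sub>R T) \<bullet> T)) (at 0)"
      unfolding h_def using \<gamma>_derivative[of 0] \<epsilon>
      by (auto intro!: derivative_eq_intros simp: has_vector_derivative_def)
    then have h': "(h has_field_derivative T \<bullet> T) (at 0)"
      by (simp add: has_field_derivative_def mult.commute[of _ "T \<bullet> T"])
    have TT: "T \<bullet> T > 0" using T_nonzero by simp
    obtain d2 where d2: "d2 > 0" "\<And>s. s > 0 \<Longrightarrow> s < d2 \<Longrightarrow> h 0 < h (0 + s)"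
      using DERIV_pos_inc_right[OF h' TT] by blast
    obtain d3 where d3: "d3 > 0" "\<And>s. s > 0 \<Longrightarrow> s < d3 \<Longrightarrow> h (0 - s) < h 0"
      using DERIV_pos_inc_left[OF h' TT] by blast
    define \<tau> where "\<tau> = min (min \<delta> \<epsilon>) (min d1 (min d2 d3)) / 2"
    have \<tau>: "0 < \<tau>" "\<tau> < \<delta>" "\<tau> < \<epsilon>" "\<tau> < d1" "\<tau> < d2" "\<tau> < d3"
      using \<delta> \<epsilon> d1(1) d2(1) d3(1) by (auto simp: \<tau>_def)
    have h0: "h 0 = 0" by (simp add: h_def \<gamma>0)
    have h\<tau>: "h (- \<tau>) < 0" "0 < h \<tau>" using d2(2)[of \<tau>] d3(2)[of \<tau>] \<tau> h0 by auto
    define m where "m = min (h \<tau>) (- h (- \<tau>))"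
    have m: "m > 0" using h\<tau> by (simp add: m_def)
    define R where "R = min R0 (m / norm T)"
    have R: "R > 0" "R \<le> R0" "R \<le> m / norm T" using m R0 T_nonzero by (auto simp: R_def)
    have "\<exists>t. \<bar>t\<bar> < \<delta> \<and> \<bar>t\<bar> < \<epsilon> \<and> norm (q - \<gamma> t) \<le> 1 / c * \<bar>\<Lambda> q\<bar>" if q: "q \<in> ball p R" for q
    proof -
      have "\<bar>(q - p) \<bullet> T\<bar> \<le> norm (q - p) * norm T" by (rule Cauchy_Schwarz_ineq2)
      also have "\<dots> \<le> (m / norm T) * norm T"
        using q R(3) by (intro mult_right_mono) (auto simp: dist_norm norm_minus_commute)
      also have "\<dots> = m" using T_nonzero by simp
      finally have le: "h (- \<tau>) \<le> (q - p) \<bullet> T" "(q - p) \<bullet> T \<le> h \<tau>" by (auto simp: m_def)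
      have "continuous_on {-\<tau>..\<tau>} h"
        unfolding h_def using isCont_\<gamma> \<tau>
        by (intro continuous_intros continuous_at_imp_continuous_on) auto
      then obtain t where t: "-\<tau> \<le> t" "t \<le> \<tau>" "h t = (q - p) \<bullet> T"
        using IVT'[of h "-\<tau>" "(q - p) \<bullet> T" \<tau>] le \<tau>(1) by auto
      have ts: "\<bar>t\<bar> < \<delta>" "\<bar>t\<bar> < \<epsilon>" "\<bar>t\<bar> < d1" using t \<tau> by auto
      have "(q - \<gamma> t) \<bullet> T = 0" using t(3) by (simp add: h_def algebra_simps)
      then have "c * norm (q - \<gamma> t) \<le> \<bar>\<Lambda> q - \<Lambda> (\<gamma> t)\<bar>"
        using q R(2) d1(2)[OF ts(3)] by (intro R0(4)) auto
      then have "norm (q - \<gamma> t) \<le> 1 / c * \<bar>\<Lambda> q\<bar>"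
        using \<Lambda>_\<gamma>[OF ts(2)] R0(2) by (simp add: field_simps)
      then show ?thesis using ts by blast
    qed
    moreover have "ball p R \<subseteq> U" using R(2) R0(3) subset_ball by blast
    ultimately show ?thesis using R(1) by blast
  qed
  moreover have "1 / c \<ge> 0" using R0(2) by simp
  ultimately show ?thesis by blast
qed

lemma null_field:
  obtains N where "open N" "p \<in> N" "N \<subseteq> U" "smooth_on \<eta> N"
    "\<And>q. q \<in> N \<Longrightarrow> \<Lambda> q = 0 \<Longrightarrow> Df q (\<eta> q) = 0"
proof -
  obtain N where N: "open N" "p \<in> N" "N \<subseteq> U" "smooth_on \<eta> N"
    "\<forall>q\<in>sing_set U f \<inter> N. Df q (\<eta> q) = 0"
    using first_kind by (auto simp: first_kind_def null_vector_field_def)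
  then show thesis using sing_set_iff by (intro that[of N]) auto
qed

lemma area2_T_\<eta>: "area2 T (\<eta> p) \<noteq> 0"
proof
  assume *: "area2 T (\<eta> p) = 0"
  have "\<eta> p \<in> span {T}"
  proof -
    have "\<eta> p \<bullet> curve_normal = 0" using * by (simp add: area2_def inner_vec_def sum_2 curve_normal_components mult.commute)
    then have "(T \<bullet> T) *\<^sub>R \<eta> p = (\<eta> p \<bullet> T) *\<^sub>R T" using orthogonal_decomposition[of "\<eta> p"] by simp
    then have "inverse (T \<bullet> T) *\<^sub>R ((T \<bullet> T) *\<^sub>R \<eta> p) = inverse (T \<bullet> T) *\<^sub>R ((\<eta> p \<bullet> T) *\<^sub>R T)"
      by (rule arg_cong)
    then have "\<eta> p = (inverse (T \<bullet> T) * (\<eta> p \<bullet> T)) *\<^sub>R T" using T_nonzero by simp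
    then show ?thesis by (metis insertI1 span_base span_scale)
  qed
  then show False using first_kind by (simp add: first_kind_def)
qed

text \<open>Otherwise \<open>df\<close> would vanish at \<open>p\<close>, and then \<open>\<Lambda>\<close>, a product with the two vanishing factors
  \<open>f\<^sub>u\<close> and \<open>f\<^sub>v\<close>, would have derivative zero there, against non-degeneracy.\<close>

lemma Df_T_nonzero: "Df p T \<noteq> 0"
proof
  assume T0: "Df p T = 0"
  let ?y = "\<eta> p"
  have \<eta>0: "Df p ?y = 0"
  proof -
    obtain N where "p \<in> N" "\<And>q. q \<in> N \<Longrightarrow> \<Lambda> q = 0 \<Longrightarrow> Df q (\<eta> q) = 0"
      using null_field by blast
    then show ?thesis using \<Lambda>_\<gamma>[of 0] \<gamma>0 \<epsilon> by simp
  qed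
  have lin: "linear (Df p)" by (rule has_derivative_linear[OF has_derivative_f[OF p_in_U]])
  have e: "?y $ 2 *\<^sub>R T - T $ 2 *\<^sub>R ?y = area2 T ?y *\<^sub>R axis 1 1"
    "T $ 1 *\<^sub>R ?y - ?y $ 1 *\<^sub>R T = area2 T ?y *\<^sub>R axis 2 1"
    by (simp_all add: vec_eq_iff forall_2 axis_def area2_def algebra_simps)
  have "area2 T ?y *\<^sub>R D1 f p = 0" "area2 T ?y *\<^sub>R D2 f p = 0"
    unfolding D1_def D2_def linear_scale[OF lin, symmetric] e[symmetric]
    by (simp_all add: linear_diff[OF lin] linear_scale[OF lin] T0 \<eta>0)
  then have z: "D1 f p = 0" "D2 f p = 0" using area2_T_\<eta> by auto
  have d: "(g has_derivative frechet_derivative g (at p)) (at p)" if "Ck_on 1 g U" for g :: "real^2 \<Rightarrow> real^3"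
    using that p_in_U Ck_on_has_derivative[of 0] by simp
  have "((\<lambda>q. cross3 (D2 f q) (\<nu> q)) has_derivative
      (\<lambda>X. cross3 (D2 f p) (D\<nu> p X) + cross3 (frechet_derivative (D2 f) (at p) X) (\<nu> p))) (at p)"
    by (intro bounded_bilinear.FDERIV[OF bilinear_cross[unfolded bilinear_conv_bounded_bilinear]]
        d Ck_on_D has_derivative_\<nu> p_in_U)
  then have "(\<Lambda> has_derivative (\<lambda>X. 0)) (at p)"
    unfolding area_density_def[abs_def] det3_cross
    by (auto intro!: has_derivative_eq_rhs[OF has_derivative_inner[OF d[OF Ck_on_D(1)]]] simp: z)
  from frechet_derivative_at[OF this, symmetric] show False using D\<Lambda>_curve_normal by simp
qed

text \<open>Along \<open>\<gamma>\<close>, \<open>\<psi>\<close> is \<open>2A\<close> times the area spanned by the velocity of \<open>\<gamma>\<close> and by \<open>\<eta>\<close>, and this area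
  does not vanish near \<open>0\<close> at a singular point of the first kind.  The product formula also shows
  that \<open>\<psi>\<close> is smooth near \<open>0\<close>.\<close>

lemma psi_sgn:
  "\<exists>\<delta>>0. \<delta> \<le> \<epsilon> \<and> (\<forall>k. Ck_on k (psi f \<nu> \<gamma> \<eta>) {-\<delta><..<\<delta>}) \<and>
    (\<forall>t. \<bar>t\<bar> < \<delta> \<longrightarrow> sgn (psi f \<nu> \<gamma> \<eta> t) = sgn (area2 T (\<eta> p)) * sgn (A (\<gamma> t)))"
proof -
  obtain N where N: "open N" "p \<in> N" "N \<subseteq> U" "smooth_on \<eta> N"
    "\<And>q. q \<in> N \<Longrightarrow> \<Lambda> q = 0 \<Longrightarrow> Df q (\<eta> q) = 0"
    using null_field by blast
  have "\<forall>\<^sub>F t in nhds 0. \<gamma> t \<in> N"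
    using isCont_\<gamma>[of 0] \<epsilon> N(1,2) \<gamma>0 topological_tendstoD[OF isCont_tendsto_nhds] by auto
  then obtain d1 where d1: "d1 > 0" "\<And>t. \<bar>t\<bar> < d1 \<Longrightarrow> \<gamma> t \<in> N"
    unfolding eventually_nhds_metric by auto
  define r where "r = min d1 \<epsilon>"
  have r: "r > 0" "r \<le> \<epsilon>" using d1 \<epsilon> by (auto simp: r_def)
  let ?I = "{-r<..<r}"
  define \<omega> where "\<omega> t = area2 (velocity \<gamma> t) (\<eta> (\<gamma> t))" for t
  have sub: "?I \<subseteq> {-\<epsilon><..<\<epsilon>}" using r by auto
  have in_N: "\<gamma> t \<in> N" if "t \<in> ?I" for t using that d1(2)[of t] by (auto simp: r_def)
  have C\<gamma>: "Ck_on k \<gamma> ?I" for k using Ck_on_subset[OF smooth_on_Ck_on[OF smooth_\<gamma>] sub] .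
  have C\<eta>: "Ck_on k (\<lambda>t. \<eta> (\<gamma> t)) ?I" for k
    by (rule Ck_on_compose[OF _ in_N smooth_on_Ck_on[OF N(4)] C\<gamma>]) simp
  have CA: "Ck_on k (\<lambda>t. A (\<gamma> t)) ?I" for k
    by (rule Ck_on_compose[OF _ _ Ck_on_mean_numerator C\<gamma>]) (use in_N N(3) in auto)
  have "Ck_on k (velocity \<gamma>) ?I" for k
    by (rule Ck_on_subset[OF Ck_on_velocity[OF smooth_\<gamma>] sub]) simp
  then have C\<omega>: "Ck_on k \<omega> ?I" for k
    unfolding \<omega>_def[abs_def] using C\<eta> by (intro bounded_bilinear.Ck_on[OF bounded_bilinear_area2]) auto
  have C: "Ck_on k (\<lambda>t. \<omega> t * (2 * A (\<gamma> t))) ?I" for k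
    by (intro bounded_bilinear.Ck_on[OF bounded_bilinear_mult] C\<omega> Ck_on_const CA) auto
  have psi: "\<omega> t * (2 * A (\<gamma> t)) = psi f \<nu> \<gamma> \<eta> t" if t: "t \<in> ?I" for t
  proof -
    have t': "\<bar>t\<bar> < \<epsilon>" using t r(2) by auto
    have "(f has_derivative Df (\<gamma> t)) (at (\<gamma> t))" by (rule has_derivative_f[OF \<gamma>_in_U[OF t']])
    then have "((f \<circ> \<gamma>) has_vector_derivative Df (\<gamma> t) (velocity \<gamma> t)) (at t)"
      using vector_derivative_diff_chain_within[of \<gamma> "velocity \<gamma> t" t UNIV f "Df (\<gamma> t)"]
        \<gamma>_derivative[OF t'] has_derivative_at_withinI by blast
    then have "velocity (f \<circ> \<gamma>) t = Df (\<gamma> t) (velocity \<gamma> t)"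
      unfolding velocity_def by (rule vector_derivative_at)
    then show ?thesis
      unfolding psi_def \<omega>_def
      using mean_numerator_null[OF \<gamma>_in_U[OF t'] N(5)[OF in_N[OF t] \<Lambda>_\<gamma>[OF t']]] by simp
  qed
  have "isCont \<omega> 0"
    using Ck_on_imp_continuous_on[OF C\<omega>[of 0]] r(1) continuous_on_eq_continuous_at[of ?I \<omega>] by simp
  moreover have \<omega>0: "\<omega> 0 = area2 T (\<eta> p)" by (simp add: \<omega>_def \<gamma>0)
  ultimately have "\<forall>\<^sub>F t in nhds 0. dist (\<omega> t) (\<omega> 0) < \<bar>\<omega> 0\<bar>"
    using area2_T_\<eta> by (intro tendstoD[OF isCont_tendsto_nhds]) auto
  then obtain d2 where d2: "d2 > 0" "\<And>t. \<bar>t\<bar> < d2 \<Longrightarrow> \<bar>\<omega> t - \<omega> 0\<bar> < \<bar>\<omega> 0\<bar>"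
    unfolding eventually_nhds_metric by (auto simp: dist_real_def)
  define \<delta> where "\<delta> = min r d2"
  have \<delta>: "\<delta> > 0" "\<delta> \<le> r" "\<delta> \<le> d2" using r d2 by (auto simp: \<delta>_def)
  have "Ck_on k (psi f \<nu> \<gamma> \<eta>) {-\<delta><..<\<delta>}" for k
    by (rule Ck_on_subset[OF Ck_on_cong[OF _ psi C]]) (use \<delta> in auto)
  moreover have "sgn (psi f \<nu> \<gamma> \<eta> t) = sgn (area2 T (\<eta> p)) * sgn (A (\<gamma> t))" if "\<bar>t\<bar> < \<delta>" for t
  proof -
    have "t \<in> ?I" using that \<delta> by auto
    then have "sgn (psi f \<nu> \<gamma> \<eta> t) = sgn (\<omega> t) * sgn (A (\<gamma> t))"
      by (simp add: psi[symmetric] sgn_mult)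
    then show ?thesis using sgn_eq_if_close[OF d2(2)[of t]] that \<delta> \<omega>0 by simp
  qed
  ultimately show ?thesis using \<delta> r by (intro exI[of _ \<delta>]) auto
qed

lemma mean_numerator_sign:
  assumes "non_front m f \<nu> \<gamma> \<eta>"
  shows "\<exists>s\<in>{1, -1}. \<exists>\<delta>>0. \<delta> \<le> \<epsilon> \<and> (\<forall>t. \<bar>t\<bar> < \<delta> \<longrightarrow> sgn (A (\<gamma> t)) = s * sgn t ^ m)"
proof -
  let ?\<psi> = "psi f \<nu> \<gamma> \<eta>"
  have m: "m \<ge> 1" "\<forall>j<m. (deriv ^^ j) ?\<psi> 0 = 0" "(deriv ^^ m) ?\<psi> 0 \<noteq> 0"
    using assms by (auto simp: non_front_def)
  obtain \<delta> where \<delta>: "\<delta> > 0" "\<delta> \<le> \<epsilon>" "Ck_on m ?\<psi> {-\<delta><..<\<delta>}"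
    "\<And>t. \<bar>t\<bar> < \<delta> \<Longrightarrow> sgn (?\<psi> t) = sgn (area2 T (\<eta> p)) * sgn (A (\<gamma> t))"
    using psi_sgn by blast
  obtain \<delta>' where \<delta>': "\<delta>' > 0"
    "\<And>t. t \<noteq> 0 \<Longrightarrow> \<bar>t\<bar> < \<delta>' \<Longrightarrow> sgn (?\<psi> t) = sgn ((deriv ^^ m) ?\<psi> 0) * sgn t ^ m"
    using sgn_at_zero_of_finite_order[OF \<delta>(1,3) m(2,3)] by blast
  define s where "s = sgn (area2 T (\<eta> p)) * sgn ((deriv ^^ m) ?\<psi> 0)"
  have s: "s \<in> {1, -1}" using area2_T_\<eta> m(3) by (auto simp: s_def sgn_if)
  have sq: "sgn (area2 T (\<eta> p)) * (sgn (area2 T (\<eta> p)) * y) = y" for y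
    using area2_T_\<eta> by (auto simp: sgn_if)
  have "?\<psi> 0 = 0" using m(1,2) by (metis funpow_0 less_eq_Suc_le One_nat_def)
  then have \<psi>: "sgn (?\<psi> t) = sgn ((deriv ^^ m) ?\<psi> 0) * sgn t ^ m" if "\<bar>t\<bar> < \<delta>'" for t
    using \<delta>'(2)[of t] that m(1) by (cases "t = 0") auto
  have "sgn (A (\<gamma> t)) = s * sgn t ^ m" if "\<bar>t\<bar> < min \<delta> \<delta>'" for t
  proof -
    have "sgn (A (\<gamma> t)) = sgn (area2 T (\<eta> p)) * sgn (?\<psi> t)"
      using \<delta>(4)[of t] that sq by simp
    then show ?thesis using \<psi>[of t] that by (simp add: s_def)
  qed
  then show ?thesis using s \<delta>(1,2) \<delta>'(1) by (intro bexI[of _ s] exI[of _ "min \<delta> \<delta>'"]) auto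
qed

lemma normal_curvature_near:
  "isCont (normal_curvature T) p \<and> (\<exists>R>0. ball p R \<subseteq> U \<and>
    (\<forall>q\<in>ball p R. \<Lambda> q = 0 \<longrightarrow> B q = 2 * normal_curvature T q * A q))"
proof -
  have "continuous_on U (\<lambda>q. Df q T)" "continuous_on U (\<lambda>q. D\<nu> q T)"
    using smooth_on_Ck_on[OF smooth_f, of "Suc 0"] smooth_on_Ck_on[OF smooth_\<nu>, of "Suc 0"] by auto
  then have c: "isCont (\<lambda>q. Df q T) p" "isCont (\<lambda>q. D\<nu> q T) p"
    using U p_in_U continuous_on_eq_continuous_at by blast+
  have k: "isCont (normal_curvature T) p"
    unfolding normal_curvature_def[abs_def] using Df_T_nonzero by (intro continuous_intros c) auto
  obtain N where N: "open N" "p \<in> N" "N \<subseteq> U" "smooth_on \<eta> N"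
    "\<And>q. q \<in> N \<Longrightarrow> \<Lambda> q = 0 \<Longrightarrow> Df q (\<eta> q) = 0"
    using null_field by blast
  have "continuous_on N \<eta>" using Ck_on_imp_continuous_on smooth_on_Ck_on[OF N(4)] by blast
  then have "isCont \<eta> p" using N continuous_on_eq_continuous_at by blast
  then have "isCont (\<lambda>q. area2 T (\<eta> q)) p"
    by (intro bounded_linear.isCont[OF bounded_bilinear.bounded_linear_right[OF bounded_bilinear_area2]])
  then have "\<forall>\<^sub>F q in nhds p. area2 T (\<eta> q) \<noteq> 0"
    using tendsto_imp_eventually_ne[OF isCont_tendsto_nhds] area2_T_\<eta> by blast
  moreover have "\<forall>\<^sub>F q in nhds p. Df q T \<noteq> 0"
    using tendsto_imp_eventually_ne[OF isCont_tendsto_nhds[OF c(1)]] Df_T_nonzero by blast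
  ultimately have "\<forall>\<^sub>F q in nhds p. area2 T (\<eta> q) \<noteq> 0 \<and> Df q T \<noteq> 0 \<and> q \<in> N"
    using eventually_nhds_in_open[OF N(1,2)] by (intro eventually_conj)
  then obtain R where R: "R > 0" "\<And>q. dist q p < R \<Longrightarrow> area2 T (\<eta> q) \<noteq> 0 \<and> Df q T \<noteq> 0 \<and> q \<in> N"
    unfolding eventually_nhds_metric by blast
  have "ball p R \<subseteq> U" using R(2) N(3) by (auto simp: dist_commute)
  moreover have "B q = 2 * normal_curvature T q * A q" if "q \<in> ball p R" "\<Lambda> q = 0" for q
  proof -
    have q: "area2 T (\<eta> q) \<noteq> 0" "Df q T \<noteq> 0" "q \<in> N" using R(2)[of q] that by (auto simp: dist_commute)
    show ?thesis using q N(3) N(5)[OF q(3) that(2)] by (intro gauss_numerator_null[where Y = "\<eta> q"]) auto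
  qed
  ultimately show ?thesis using k R(1) by blast
qed

end

section \<open>The two branches near a non-front singular point\<close>

context first_kind_point
begin

lemma curve_parameter_unique:
  "\<bar>t\<bar> < \<epsilon> \<Longrightarrow> \<bar>t'\<bar> < \<epsilon> \<Longrightarrow> \<gamma> t = \<gamma> t' \<longleftrightarrow> t = t'"
  using inj_onD[OF inj_\<gamma>, of t t'] by (auto simp: abs_less_iff)

text \<open>The common ground of the cases of even and odd order: in a small disc the sign of \<open>A\<close> at a singular
  point can be read off from its parameter on \<open>\<gamma>\<close>, and it determines the branch that blows up there.\<close>

lemma good_neighbourhood:
  assumes "\<delta> > 0"
  shows "\<exists>R>0. ball p R \<subseteq> U
    \<and> (\<forall>q\<in>ball p R. \<Lambda> q = 0 \<longrightarrow> (\<exists>t. \<bar>t\<bar> < \<delta> \<and> \<bar>t\<bar> < \<epsilon> \<and> q = \<gamma> t))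
    \<and> (\<forall>q\<in>ball p R. \<forall>s\<in>{1, -1}. \<Lambda> q = 0 \<longrightarrow> s * A q > 0 \<longrightarrow>
          unbounded_near U (sing_set U f) (principal_curvature s f \<nu>) q)"
proof -
  obtain R1 where R1: "R1 > 0" "ball p R1 \<subseteq> U"
    "\<And>q V. q \<in> ball p R1 \<Longrightarrow> \<Lambda> q = 0 \<Longrightarrow> open V \<Longrightarrow> q \<in> V \<Longrightarrow> \<exists>x\<in>V \<inter> U. \<Lambda> x \<noteq> 0"
    using regular_points_dense by blast
  obtain C R2 where R2: "R2 > 0"
    "\<And>q. q \<in> ball p R2 \<Longrightarrow> \<exists>t. \<bar>t\<bar> < \<delta> \<and> \<bar>t\<bar> < \<epsilon> \<and> norm (q - \<gamma> t) \<le> C * \<bar>\<Lambda> q\<bar>"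
    using distance_to_singular_curve assms by blast
  have "unbounded_near U (sing_set U f) (principal_curvature s f \<nu>) q"
    if "q \<in> ball p (min R1 R2)" "s \<in> {1, -1}" "\<Lambda> q = 0" "s * A q > 0" for q s
    using that R1 by (intro unbounded_near_singular) auto
  moreover have "\<exists>t. \<bar>t\<bar> < \<delta> \<and> \<bar>t\<bar> < \<epsilon> \<and> q = \<gamma> t" if "q \<in> ball p (min R1 R2)" "\<Lambda> q = 0" for q
    using R2(2)[of q] that by auto
  moreover have "ball p (min R1 R2) \<subseteq> U" using R1 by auto
  moreover have "min R1 R2 > 0" using R1 R2 by simp
  ultimately show ?thesis by blast
qed

text \<open>Every neighbourhood of \<open>p\<close> is also a neighbourhood of \<open>\<gamma> t\<close> for all small \<open>t\<close>, so it is enough that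
  \<open>h\<close> be unbounded along one half of the curve, the one where \<open>t\<close> has the sign of \<open>a\<close>.\<close>

lemma unbounded_near_p:
  assumes "\<delta> > 0" "a \<noteq> 0"
    and "\<And>t. \<bar>t\<bar> < \<delta> \<Longrightarrow> a * t > 0 \<Longrightarrow> unbounded_near U (sing_set U f) h (\<gamma> t)"
  shows "unbounded_near U (sing_set U f) h p"
  unfolding unbounded_near_def
proof (intro allI impI)
  fix V assume V: "open V" "p \<in> V"
  have "\<forall>\<^sub>F t in nhds 0. \<gamma> t \<in> V"
    using isCont_\<gamma>[of 0] \<epsilon> V \<gamma>0 topological_tendstoD[OF isCont_tendsto_nhds] by auto
  then obtain d where d: "d > 0" "\<And>t. \<bar>t\<bar> < d \<Longrightarrow> \<gamma> t \<in> V"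
    unfolding eventually_nhds_metric by auto
  define t where "t = sgn a * (min d \<delta> / 2)"
  have "\<bar>t\<bar> = min d \<delta> / 2" using assms(1,2) d(1) by (simp add: t_def abs_mult)
  then have t: "\<bar>t\<bar> < d" "\<bar>t\<bar> < \<delta>" using assms(1) d(1) by auto
  have "\<bar>a\<bar> * (min d \<delta> / 2) > 0" using assms(1,2) d(1) by simp
  then have "a * t > 0" by (simp add: t_def abs_sgn)
  then show "\<not> bounded (h ` (V \<inter> (U - sing_set U f)))"
    using assms(3)[of t] t d(2)[of t] V(1) by (simp add: unbounded_near_def)
qed

text \<open>A point \<open>q\<close> is compared with a point \<open>\<gamma> t\<close> at distance \<open>O(\<Lambda> q)\<close>.  There \<open>B = 2\<kappa>A\<close> holds exactly, and
  since \<open>A\<close> and \<open>B\<close> are Lipschitz, it holds at \<open>q\<close> up to \<open>O(\<Lambda> q)\<close>; in the same way the sign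
  condition on \<open>A\<close> holds at \<open>q\<close> up to \<open>O(\<Lambda> q)\<close>.  This is the situation of
  \<open>quadratic_root_bounded\<close>.\<close>

lemma bounded_branch_near_p:
  assumes s: "s \<in> {1, -1}" and \<delta>: "\<delta> > 0" and sA: "\<And>t. \<bar>t\<bar> < \<delta> \<Longrightarrow> s * A (\<gamma> t) \<le> 0"
  shows "\<exists>R>0. \<exists>M. ball p R \<subseteq> U
    \<and> (\<forall>q\<in>ball p R. \<Lambda> q \<noteq> 0 \<longrightarrow> \<bar>principal_curvature s f \<nu> q\<bar> \<le> M)
    \<and> (\<forall>q\<in>ball p R. \<bar>normal_curvature T q\<bar> \<le> M)
    \<and> (\<forall>q\<in>ball p R. \<Lambda> q = 0 \<longrightarrow> B q = 2 * normal_curvature T q * A q)"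
proof -
  let ?\<kappa> = "normal_curvature T"
  obtain C where C: "C \<ge> 0" and tube: "\<And>\<delta>. \<delta> > 0 \<Longrightarrow> \<exists>R>0. ball p R \<subseteq> U \<and>
    (\<forall>q\<in>ball p R. \<exists>t. \<bar>t\<bar> < \<delta> \<and> \<bar>t\<bar> < \<epsilon> \<and> norm (q - \<gamma> t) \<le> C * \<bar>\<Lambda> q\<bar>)"
    using distance_to_singular_curve by blast
  obtain R1 where R1: "R1 > 0" "ball p R1 \<subseteq> U"
    "\<And>q. q \<in> ball p R1 \<Longrightarrow> \<Lambda> q = 0 \<Longrightarrow> B q = 2 * ?\<kappa> q * A q"
    using normal_curvature_near by blast
  have "\<forall>\<^sub>F q in nhds p. dist (?\<kappa> q) (?\<kappa> p) < 1"
    using normal_curvature_near by (intro tendstoD[OF isCont_tendsto_nhds]) auto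
  then obtain R2 where R2: "R2 > 0" "\<And>q. dist q p < R2 \<Longrightarrow> dist (?\<kappa> q) (?\<kappa> p) < 1"
    unfolding eventually_nhds_metric by blast
  define K where "K = \<bar>?\<kappa> p\<bar> + 1"
  have K: "\<bar>?\<kappa> q\<bar> \<le> K" if "q \<in> ball p R2" for q
    using R2(2)[of q] that by (auto simp: K_def dist_commute dist_real_def)
  obtain R3 LA where R3: "R3 > 0" "LA \<ge> 0"
    "\<And>x y. x \<in> ball p R3 \<Longrightarrow> y \<in> ball p R3 \<Longrightarrow> \<bar>A x - A y\<bar> \<le> LA * norm (x - y)"
    using C1_locally_Lipschitz[OF U Ck_on_mean_numerator p_in_U] by blast
  obtain R4 LB where R4: "R4 > 0" "LB \<ge> 0"
    "\<And>x y. x \<in> ball p R4 \<Longrightarrow> y \<in> ball p R4 \<Longrightarrow> \<bar>B x - B y\<bar> \<le> LB * norm (x - y)"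
    using C1_locally_Lipschitz[OF U Ck_on_gauss_numerator p_in_U] by blast
  define R where "R = min (min R1 R2) (min R3 R4)"
  have R: "R > 0" "ball p R \<subseteq> ball p R1" "ball p R \<subseteq> ball p R2" "ball p R \<subseteq> ball p R3" "ball p R \<subseteq> ball p R4"
    using R1 R2 R3 R4 by (auto simp: R_def)
  have "\<forall>\<^sub>F t in nhds 0. dist (\<gamma> t) (\<gamma> 0) < R"
    using R(1) isCont_\<gamma>[of 0] \<epsilon> by (intro tendstoD[OF isCont_tendsto_nhds]) auto
  then obtain d where d: "d > 0" "\<And>t. \<bar>t\<bar> < d \<Longrightarrow> \<gamma> t \<in> ball p R"
    unfolding eventually_nhds_metric by (auto simp: \<gamma>0 dist_commute)
  obtain R5 where R5: "R5 > 0" "\<And>q. q \<in> ball p R5 \<Longrightarrow>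
      \<exists>t. \<bar>t\<bar> < min d \<delta> \<and> \<bar>t\<bar> < \<epsilon> \<and> norm (q - \<gamma> t) \<le> C * \<bar>\<Lambda> q\<bar>"
    using tube[of "min d \<delta>"] d(1) \<delta> by auto
  define L where "L = K + (LB + (2 * K + 1) * LA) * C"
  have K0: "K \<ge> 0" by (simp add: K_def)
  have L: "L \<ge> 0" "K \<le> L" "LA * C \<le> L" "(LB + 2 * K * LA) * C \<le> L"
    using K0 C R3(2) R4(2) by (auto simp: L_def algebra_simps)
  have main: "\<bar>principal_curvature s f \<nu> q\<bar> \<le> 10 * L + 4"
    if q: "q \<in> ball p (min R R5)" "\<Lambda> q \<noteq> 0" for q
  proof -
    have q': "q \<in> ball p R" "q \<in> ball p R5" using q by auto
    obtain t where t: "\<bar>t\<bar> < d" "\<bar>t\<bar> < \<delta>" "\<bar>t\<bar> < \<epsilon>" "norm (q - \<gamma> t) \<le> C * \<bar>\<Lambda> q\<bar>"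
      using R5(2)[OF q'(2)] by auto
    let ?y = "\<gamma> t" and ?k = "?\<kappa> (\<gamma> t)"
    have y: "?y \<in> ball p R" by (rule d(2)[OF t(1)])
    have "\<bar>A q - A ?y\<bar> \<le> LA * norm (q - ?y)" using R3(3) R(4) q'(1) y by blast
    also have "\<dots> \<le> LA * (C * \<bar>\<Lambda> q\<bar>)" by (rule mult_left_mono[OF t(4) R3(2)])
    finally have dA: "\<bar>A q - A ?y\<bar> \<le> LA * C * \<bar>\<Lambda> q\<bar>" by simp
    have "\<bar>B q - B ?y\<bar> \<le> LB * norm (q - ?y)" using R4(3) R(5) q'(1) y by blast
    also have "\<dots> \<le> LB * (C * \<bar>\<Lambda> q\<bar>)" by (rule mult_left_mono[OF t(4) R4(2)])
    finally have dB: "\<bar>B q - B ?y\<bar> \<le> LB * C * \<bar>\<Lambda> q\<bar>" by simp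
    have k: "\<bar>?k\<bar> \<le> K" using K R(3) y by blast
    have up: "c * \<bar>\<Lambda> q\<bar> \<le> L * \<bar>\<Lambda> q\<bar>" if "c \<le> L" for c by (rule mult_right_mono[OF that]) simp
    have By: "B ?y = 2 * ?k * A ?y" using R1(3) R(2) y \<Lambda>_\<gamma>[OF t(3)] by blast
    have "\<bar>B q - 2 * ?k * A q\<bar> \<le> L * \<bar>\<Lambda> q\<bar>"
    proof -
      have "B q - 2 * ?k * A q = (B q - B ?y) - 2 * ?k * (A q - A ?y)"
        unfolding By by (simp add: algebra_simps)
      then have "\<bar>B q - 2 * ?k * A q\<bar> \<le> \<bar>B q - B ?y\<bar> + \<bar>2 * ?k * (A q - A ?y)\<bar>" by linarith
      also have "\<bar>2 * ?k * (A q - A ?y)\<bar> = 2 * \<bar>?k\<bar> * \<bar>A q - A ?y\<bar>" by (simp add: abs_mult)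
      also have "\<dots> \<le> 2 * K * (LA * C * \<bar>\<Lambda> q\<bar>)"
        using k dA K0 by (intro mult_mono) auto
      finally have "\<bar>B q - 2 * ?k * A q\<bar> \<le> (LB + 2 * K * LA) * C * \<bar>\<Lambda> q\<bar>"
        using dB by (simp add: algebra_simps)
      then show ?thesis using up[OF L(4)] by linarith
    qed
    moreover have "\<bar>?k\<bar> \<le> L" using k L(2) by linarith
    moreover have "s * A q \<le> L * \<bar>\<Lambda> q\<bar>"
    proof -
      have "s * A q \<le> s * A ?y + \<bar>A q - A ?y\<bar>" using s by auto
      then show ?thesis using sA[OF t(2)] dA up[OF L(3)] by linarith
    qed
    moreover have "q \<in> U" using q'(1) R(2) R1(2) by blast
    ultimately show ?thesis
      using quadratic_root_bounded[OF s q(2)] by (simp add: principal_curvature_quotient)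
  qed
  have sub: "ball p (min R R5) \<subseteq> ball p R" by auto
  have "\<bar>?\<kappa> q\<bar> \<le> 10 * L + 4" if "q \<in> ball p (min R R5)" for q
  proof -
    have "\<bar>?\<kappa> q\<bar> \<le> K" using K sub R(3) that by blast
    then show ?thesis using L by linarith
  qed
  moreover have "min R R5 > 0" using R R5 by simp
  moreover have "ball p (min R R5) \<subseteq> U" using sub R(2) R1(2) by blast
  moreover have "B q = 2 * ?\<kappa> q * A q" if "q \<in> ball p (min R R5)" "\<Lambda> q = 0" for q
    using R1(3) sub R(2) that by blast
  ultimately show ?thesis using main by blast
qed

text \<open>For even order \<open>A\<close> has the same sign on both halves of \<open>\<gamma>\<close>, so that one and the same branch
  extends on both sides of \<open>p\<close>.  On the singular set away from \<open>p\<close>, the extension \<open>B / (2A)\<close> is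
  equal to the normal curvature, which is continuous at \<open>p\<close> as well.\<close>

lemma even_order:
  assumes s: "s \<in> {1, -1}" and \<delta>: "\<delta> > 0" "\<delta> \<le> \<epsilon>"
    and sgnA: "\<And>t. \<bar>t\<bar> < \<delta> \<Longrightarrow> sgn (A (\<gamma> t)) = - s * sgn t ^ (2 * k)" and k: "k \<ge> 1"
  shows "\<exists>W. open W \<and> p \<in> W \<and> W \<subseteq> U
    \<and> extends_continuously_near (sing_set U f) (principal_curvature s f \<nu>) W p
    \<and> unbounded_near U (sing_set U f) (principal_curvature (- s) f \<nu>) p"
proof -
  let ?\<kappa> = "normal_curvature T"
  have sA: "s * A (\<gamma> t) < 0" if "\<bar>t\<bar> < \<delta>" "t \<noteq> 0" for t
    using sgnA[OF that(1)] s that(2) by (auto simp: sgn_if power_mult split: if_splits)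
  have A0: "A p = 0" using sgnA[of 0] \<delta>(1) k \<gamma>0 by (simp add: sgn_0_0 zero_power)
  then have sA': "s * A (\<gamma> t) \<le> 0" if "\<bar>t\<bar> < \<delta>" for t
    using sA[OF that] \<gamma>0 by (cases "t = 0") auto
  obtain R1 M where R1: "R1 > 0" "ball p R1 \<subseteq> U"
    "\<And>q. q \<in> ball p R1 \<Longrightarrow> \<Lambda> q \<noteq> 0 \<Longrightarrow> \<bar>principal_curvature s f \<nu> q\<bar> \<le> M"
    "\<And>q. q \<in> ball p R1 \<Longrightarrow> \<bar>?\<kappa> q\<bar> \<le> M"
    "\<And>q. q \<in> ball p R1 \<Longrightarrow> \<Lambda> q = 0 \<Longrightarrow> B q = 2 * ?\<kappa> q * A q"
    using bounded_branch_near_p[OF s \<delta>(1) sA'] by blast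
  obtain R2 where R2: "R2 > 0"
    "\<And>q. q \<in> ball p R2 \<Longrightarrow> \<Lambda> q = 0 \<Longrightarrow> \<exists>t. \<bar>t\<bar> < \<delta> \<and> \<bar>t\<bar> < \<epsilon> \<and> q = \<gamma> t"
    "\<And>q s. q \<in> ball p R2 \<Longrightarrow> s \<in> {1, -1} \<Longrightarrow> \<Lambda> q = 0 \<Longrightarrow> s * A q > 0 \<Longrightarrow>
      unbounded_near U (sing_set U f) (principal_curvature s f \<nu>) q"
    using good_neighbourhood[OF \<delta>(1)] by blast
  define W where "W = ball p (min R1 R2)"
  have W: "open W" "p \<in> W" "W \<subseteq> ball p R1" "W \<subseteq> ball p R2" using R1(1) R2(1) by (auto simp: W_def)
  have WU: "W \<subseteq> U" using W R1 by blast
  have neg: "s * A q < 0" if q: "q \<in> W - {p}" "\<Lambda> q = 0" for q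
  proof -
    obtain t where t: "\<bar>t\<bar> < \<delta>" "q = \<gamma> t" using R2(2) W(4) q by blast
    then have "t \<noteq> 0" using q(1) \<gamma>0 by auto
    then show ?thesis using sA t by simp
  qed
  define g where "g q = (if q = p then ?\<kappa> p else extension s q)" for q
  have contg: "isCont g q" if q: "q \<in> W - {p}" for q
  proof -
    have "isCont (extension s) q"
      using isCont_extension_regular isCont_extension_singular[OF _ _ s neg[OF q]] q WU by blast
    moreover have "open (W - {p})" using W(1) by auto
    ultimately show ?thesis
      using isCont_cong_near[of "W - {p}" q "extension s" g] q by (simp add: g_def)
  qed
  have g\<kappa>: "g q = ?\<kappa> q" if "q \<in> W" "\<Lambda> q = 0" for q
    proof (cases "q = p")
    case False
    then have "s * A q < 0" using neg that by blast
    then have "A q \<noteq> 0" by auto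
    then show ?thesis using R1(5)[of q] that False W(3) by (auto simp: g_def extension_def)
  qed (simp add: g_def)
  have "continuous_on (W - {p}) g"
    using contg by (intro continuous_at_imp_continuous_on) auto
  moreover have "continuous_on (W \<inter> sing_set U f) g"
    unfolding continuous_on_eq_continuous_within
  proof
    fix q assume q: "q \<in> W \<inter> sing_set U f"
    show "continuous (at q within W \<inter> sing_set U f) g"
    proof (cases "q = p")
      case False
      then have "isCont g q" using contg q by auto
      then show ?thesis by (rule continuous_at_imp_continuous_at_within)
    next
      case True
      have "continuous (at p within W \<inter> sing_set U f) ?\<kappa>"
        by (rule continuous_at_imp_continuous_at_within[OF normal_curvature_near[THEN conjunct1]])
      then show ?thesis
        unfolding True
        by (rule continuous_transform_within[OF _ zero_less_one])
          (use q True g\<kappa> sing_set_iff WU in auto)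
    qed
  qed
  moreover have "bounded (g ` W)"
    unfolding bounded_iff
  proof (intro exI[of _ M] ballI)
    fix y assume "y \<in> g ` W"
    then obtain q where q: "q \<in> W" "y = g q" by blast
    show "norm y \<le> M"
    proof (cases "\<Lambda> q = 0")
      case True
      then show ?thesis using g\<kappa> q R1(4) W(3) by auto
    next
      case False
      moreover have "q \<noteq> p" using False \<Lambda>_\<gamma>[of 0] \<gamma>0 \<epsilon> by auto
      ultimately show ?thesis using q R1(3) W(3) by (auto simp: g_def extension_def)
    qed
  qed
  moreover have "g q = principal_curvature s f \<nu> q" if "q \<in> W - sing_set U f" for q
    using that sing_set_iff WU \<gamma>_singular[of 0] \<gamma>0 \<epsilon> by (auto simp: g_def extension_def)
  ultimately have "extends_continuously_near (sing_set U f) (principal_curvature s f \<nu>) W p"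
    unfolding extends_continuously_near_def by blast
  moreover have "unbounded_near U (sing_set U f) (principal_curvature (- s) f \<nu>) p"
  proof -
    have "\<forall>\<^sub>F t in nhds 0. dist (\<gamma> t) (\<gamma> 0) < R2"
      using R2(1) isCont_\<gamma>[of 0] \<epsilon> by (intro tendstoD[OF isCont_tendsto_nhds]) auto
    then obtain d where d: "d > 0" "\<And>t. \<bar>t\<bar> < d \<Longrightarrow> \<gamma> t \<in> ball p R2"
      unfolding eventually_nhds_metric by (auto simp: \<gamma>0 dist_commute)
    show ?thesis
    proof (rule unbounded_near_p[of "min d \<delta>" 1])
      fix t assume t: "\<bar>t\<bar> < min d \<delta>" "1 * t > 0"
      then show "unbounded_near U (sing_set U f) (principal_curvature (- s) f \<nu>) (\<gamma> t)"
        using s \<delta> d(2)[of t] \<Lambda>_\<gamma>[of t] sA[of t] by (intro R2(3)) auto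
    qed (use d \<delta> in auto)
  qed
  ultimately show ?thesis using W WU by blast
qed

text \<open>For odd order \<open>A\<close> changes sign at \<open>p\<close>, and the two branches exchange their roles there.  At
  \<open>p\<close> itself both of them are unbounded.\<close>

lemma odd_order:
  assumes s0: "s0 \<in> {1, -1}" and \<delta>: "\<delta> > 0" "\<delta> \<le> \<epsilon>"
    and sgnA: "\<And>t. \<bar>t\<bar> < \<delta> \<Longrightarrow> sgn (A (\<gamma> t)) = s0 * sgn t ^ (2 * k + 1)"
  shows "\<exists>W. open W \<and> p \<in> W \<and> W \<subseteq> U \<and> (\<forall>s\<in>{1, -1}.
    extends_continuously (sing_set U f) (principal_curvature s f \<nu>) (W - \<gamma> ` {t. \<bar>t\<bar> < \<epsilon> \<and> s * s0 * t \<ge> 0})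
    \<and> (\<forall>t. \<bar>t\<bar> < \<epsilon> \<longrightarrow> s * s0 * t \<ge> 0 \<longrightarrow> \<gamma> t \<in> W \<longrightarrow>
        unbounded_near U (sing_set U f) (principal_curvature s f \<nu>) (\<gamma> t)))"
proof -
  have odd: "sgn t ^ (2 * k + 1) = sgn t" for t :: real
    by (simp add: sgn_if power_mult)
  have sA: "sgn (s * A (\<gamma> t)) = sgn (s * s0 * t)" if "\<bar>t\<bar> < \<delta>" "s \<in> {1, -1}" for s t
    using sgnA[OF that(1)] s0 that(2) unfolding odd by (auto simp: sgn_mult)
  obtain R where R: "R > 0" "ball p R \<subseteq> U"
    "\<And>q. q \<in> ball p R \<Longrightarrow> \<Lambda> q = 0 \<Longrightarrow> \<exists>t. \<bar>t\<bar> < \<delta> \<and> \<bar>t\<bar> < \<epsilon> \<and> q = \<gamma> t"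
    "\<And>q s. q \<in> ball p R \<Longrightarrow> s \<in> {1, -1} \<Longrightarrow> \<Lambda> q = 0 \<Longrightarrow> s * A q > 0 \<Longrightarrow>
      unbounded_near U (sing_set U f) (principal_curvature s f \<nu>) q"
    using good_neighbourhood[OF \<delta>(1)] by blast
  have ext: "extends_continuously (sing_set U f) (principal_curvature s f \<nu>)
      (ball p R - \<gamma> ` {t. \<bar>t\<bar> < \<epsilon> \<and> s * s0 * t \<ge> 0})" if s: "s \<in> {1, -1}" for s
    unfolding extends_continuously_def
  proof (intro exI[of _ "extension s"] conjI ballI)
    have "isCont (extension s) q" if q: "q \<in> ball p R - \<gamma> ` {t. \<bar>t\<bar> < \<epsilon> \<and> s * s0 * t \<ge> 0}" for q
    proof (cases "\<Lambda> q = 0")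
      case True
      then obtain t where t: "\<bar>t\<bar> < \<delta>" "\<bar>t\<bar> < \<epsilon>" "q = \<gamma> t" using R(3) q by blast
      then have "s * s0 * t < 0" using q by auto
      then have "s * A q < 0" using sA[OF t(1) s] t(3) by (metis sgn_less)
      then show ?thesis using isCont_extension_singular[OF _ True s] q R(2) by blast
    next
      case False
      then show ?thesis using isCont_extension_regular q R(2) by blast
    qed
    then show "continuous_on (ball p R - \<gamma> ` {t. \<bar>t\<bar> < \<epsilon> \<and> s * s0 * t \<ge> 0}) (extension s)"
      by (intro continuous_at_imp_continuous_on) auto
    show "extension s q = principal_curvature s f \<nu> q"
      if "q \<in> ball p R - \<gamma> ` {t. \<bar>t\<bar> < \<epsilon> \<and> s * s0 * t \<ge> 0} - sing_set U f" for q
      using that sing_set_iff R(2) by (auto simp: extension_def)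
  qed
  have pos: "unbounded_near U (sing_set U f) (principal_curvature s f \<nu>) (\<gamma> t)"
    if s: "s \<in> {1, -1}" and t: "\<bar>t\<bar> < \<delta>" "s * s0 * t > 0" "\<gamma> t \<in> ball p R" for s t
    using R(4)[OF t(3) s] \<Lambda>_\<gamma>[of t] t(1) \<delta>(2) sA[OF t(1) s] t(2) by (metis less_le_trans sgn_greater)
  have "\<forall>\<^sub>F t in nhds 0. dist (\<gamma> t) (\<gamma> 0) < R"
    using R(1) isCont_\<gamma>[of 0] \<epsilon> by (intro tendstoD[OF isCont_tendsto_nhds]) auto
  then obtain d where d: "d > 0" "\<And>t. \<bar>t\<bar> < d \<Longrightarrow> \<gamma> t \<in> ball p R"
    unfolding eventually_nhds_metric by (auto simp: \<gamma>0 dist_commute)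
  have at_p: "unbounded_near U (sing_set U f) (principal_curvature s f \<nu>) p" if s: "s \<in> {1, -1}" for s
    using pos[OF s] d \<delta>(1) s s0 by (intro unbounded_near_p[of "min d \<delta>" "s * s0"]) auto
  have "unbounded_near U (sing_set U f) (principal_curvature s f \<nu>) (\<gamma> t)"
    if s: "s \<in> {1, -1}" and t: "\<bar>t\<bar> < \<epsilon>" "s * s0 * t \<ge> 0" "\<gamma> t \<in> ball p R" for s t
  proof (cases "t = 0")
    case True
    then show ?thesis using at_p[OF s] \<gamma>0 by simp
  next
    case False
    obtain t' where t': "\<bar>t'\<bar> < \<delta>" "\<bar>t'\<bar> < \<epsilon>" "\<gamma> t = \<gamma> t'" using R(3)[OF t(3)] \<Lambda>_\<gamma>[OF t(1)] by blast
    then have "\<bar>t\<bar> < \<delta>" using curve_parameter_unique t(1) by metis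
    moreover have "s * s0 * t > 0" using t(2) False s s0 by auto
    ultimately show ?thesis using pos[OF s] t(3) by blast
  qed
  then show ?thesis using ext R(1,2) by (intro exI[of _ "ball p R"]) auto
qed

end

lemma non_front_unique:
  assumes "non_front k f \<nu> \<gamma> \<eta>" "non_front l f \<nu> \<gamma> \<eta>"
  shows "k = l"
  using assms unfolding non_front_def by (metis nat_neq_iff)

theorem theorem4p1:
  fixes U :: "(real^2) set" and f \<nu> :: "real^2 \<Rightarrow> real^3" and p :: "real^2"
    and \<epsilon> :: real and \<gamma> :: "real \<Rightarrow> real^2" and \<eta> :: "real^2 \<Rightarrow> real^2"
  assumes "frontal U f \<nu>"
    and "first_kind U f \<nu> p \<epsilon> \<gamma> \<eta>"
  shows "\<exists>W. open W \<and> p \<in> W \<and> W \<subseteq> U \<and>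
    (\<forall>k\<ge>1. non_front (2 * k) f \<nu> \<gamma> \<eta> \<longrightarrow>
      (extends_continuously_near (sing_set U f) (kappa1 f \<nu>) W p \<and>
         unbounded_near U (sing_set U f) (kappa2 f \<nu>) p) \<or>
      (extends_continuously_near (sing_set U f) (kappa2 f \<nu>) W p \<and>
         unbounded_near U (sing_set U f) (kappa1 f \<nu>) p)) \<and>
    (\<forall>k. non_front (2 * k + 1) f \<nu> \<gamma> \<eta> \<longrightarrow>
      limiting_normal_curvature f \<nu> \<gamma> 0 \<noteq> 0 \<or>
        finite_multiplicity_at_0 (limiting_normal_curvature f \<nu> \<gamma>) \<longrightarrow>
      (\<exists>\<sigma>\<in>{1, -1 :: real}. let \<gamma>\<sigma> = (\<lambda>t. \<gamma> (\<sigma> * t)) in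
         extends_continuously (sing_set U f) (kappa1 f \<nu>) (W - \<gamma>\<sigma> ` {-\<epsilon><..0}) \<and>
         (\<forall>t\<in>{-\<epsilon><..0}. \<gamma>\<sigma> t \<in> W \<longrightarrow> unbounded_near U (sing_set U f) (kappa1 f \<nu>) (\<gamma>\<sigma> t)) \<and>
         extends_continuously (sing_set U f) (kappa2 f \<nu>) (W - \<gamma>\<sigma> ` {0..<\<epsilon>}) \<and>
         (\<forall>t\<in>{0..<\<epsilon>}. \<gamma>\<sigma> t \<in> W \<longrightarrow> unbounded_near U (sing_set U f) (kappa2 f \<nu>) (\<gamma>\<sigma> t))))"
proof -
  interpret first_kind_point U f \<nu> p \<epsilon> \<gamma> \<eta>
    using assms by unfold_locales
  consider (even) k where "k \<ge> 1" "non_front (2 * k) f \<nu> \<gamma> \<eta>"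
    | (odd) k where "non_front (2 * k + 1) f \<nu> \<gamma> \<eta>"
    | (none) "\<not> (\<exists>k\<ge>1. non_front (2 * k) f \<nu> \<gamma> \<eta>)" "\<not> (\<exists>k. non_front (2 * k + 1) f \<nu> \<gamma> \<eta>)"
    by blast
  then show ?thesis
  proof cases
    case none
    then show ?thesis using U p_in_U by (intro exI[of _ U]) auto
  next
    case even
    obtain s0 \<delta> where s0: "s0 \<in> {1, -1}" and \<delta>: "\<delta> > 0" "\<delta> \<le> \<epsilon>"
      "\<And>t. \<bar>t\<bar> < \<delta> \<Longrightarrow> sgn (A (\<gamma> t)) = s0 * sgn t ^ (2 * k)"
      using mean_numerator_sign[OF even(2)] by blast
    have "- s0 \<in> {1, -1}" using s0 by auto
    from even_order[OF this \<delta>(1,2) _ even(1)] \<delta>(3) obtain W where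
      W: "open W" "p \<in> W" "W \<subseteq> U"
        "extends_continuously_near (sing_set U f) (principal_curvature (- s0) f \<nu>) W p"
        "unbounded_near U (sing_set U f) (principal_curvature s0 f \<nu>) p"
      by auto
    have "\<not> non_front (2 * l + 1) f \<nu> \<gamma> \<eta>" for l
    proof -
      have "2 * k \<noteq> 2 * l + 1" by presburger
      then show ?thesis using non_front_unique[OF even(2)] by blast
    qed
    then show ?thesis using W s0 by (intro exI[of _ W]) (auto simp: kappa1_eq kappa2_eq)
  next
    case odd
    obtain s0 \<delta> where s0: "s0 \<in> {1, -1}" and \<delta>: "\<delta> > 0" "\<delta> \<le> \<epsilon>"
      "\<And>t. \<bar>t\<bar> < \<delta> \<Longrightarrow> sgn (A (\<gamma> t)) = s0 * sgn t ^ (2 * k + 1)"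
      using mean_numerator_sign[OF odd] by blast
    from odd_order[OF s0 \<delta>] obtain W where W: "open W" "p \<in> W" "W \<subseteq> U"
      and ext: "\<And>s. s \<in> {1, -1} \<Longrightarrow> extends_continuously (sing_set U f) (principal_curvature s f \<nu>)
        (W - \<gamma> ` {t. \<bar>t\<bar> < \<epsilon> \<and> s * s0 * t \<ge> 0})"
      and unb: "\<And>s t. s \<in> {1, -1} \<Longrightarrow> \<bar>t\<bar> < \<epsilon> \<Longrightarrow> s * s0 * t \<ge> 0 \<Longrightarrow> \<gamma> t \<in> W \<Longrightarrow>
        unbounded_near U (sing_set U f) (principal_curvature s f \<nu>) (\<gamma> t)"
      by blast
    \<comment> \<open>With this orientation \<open>A (\<gamma> (\<sigma> * t))\<close> is positive for small \<open>t < 0\<close> and negative for small \<open>t > 0\<close>.\<close>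
    define \<sigma> where "\<sigma> = - s0"
    have \<sigma>: "\<sigma> \<in> {1, -1}" "\<sigma> * \<sigma> = 1" using s0 by (auto simp: \<sigma>_def)
    have abs: "\<bar>\<sigma> * t\<bar> = \<bar>t\<bar>" for t using \<sigma>(1) by auto
    have im: "(\<lambda>t. \<gamma> (\<sigma> * t)) ` {t. \<bar>t\<bar> < \<epsilon> \<and> P t} = \<gamma> ` {t. \<bar>t\<bar> < \<epsilon> \<and> P (\<sigma> * t)}" for P
    proof -
      have "{t. \<bar>t\<bar> < \<epsilon> \<and> P (\<sigma> * t)} = (\<lambda>t. \<sigma> * t) ` {t. \<bar>t\<bar> < \<epsilon> \<and> P t}"
      proof (intro equalityI subsetI)
        fix t assume "t \<in> {t. \<bar>t\<bar> < \<epsilon> \<and> P (\<sigma> * t)}"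
        then show "t \<in> (\<lambda>t. \<sigma> * t) ` {t. \<bar>t\<bar> < \<epsilon> \<and> P t}"
          using abs \<sigma>(2) by (intro image_eqI[of _ _ "\<sigma> * t"]) (auto simp: mult.assoc[symmetric])
      qed (use abs \<sigma>(2) in \<open>auto simp: mult.assoc[symmetric]\<close>)
      then show ?thesis by (simp add: image_image)
    qed
    have I1: "{-\<epsilon><..0} = {t. \<bar>t\<bar> < \<epsilon> \<and> - t \<ge> 0}" and I2: "{0..<\<epsilon>} = {t. \<bar>t\<bar> < \<epsilon> \<and> t \<ge> 0}"
      by auto
    have J1: "(\<lambda>t. \<gamma> (\<sigma> * t)) ` {-\<epsilon><..0} = \<gamma> ` {t. \<bar>t\<bar> < \<epsilon> \<and> 1 * s0 * t \<ge> 0}"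
      unfolding I1 im by (simp add: \<sigma>_def)
    have J2: "(\<lambda>t. \<gamma> (\<sigma> * t)) ` {0..<\<epsilon>} = \<gamma> ` {t. \<bar>t\<bar> < \<epsilon> \<and> (-1) * s0 * t \<ge> 0}"
      unfolding I2 im by (simp add: \<sigma>_def)
    have E1: "extends_continuously (sing_set U f) (kappa1 f \<nu>) (W - (\<lambda>t. \<gamma> (\<sigma> * t)) ` {-\<epsilon><..0})"
      unfolding J1 kappa1_eq by (rule ext) simp
    have E2: "extends_continuously (sing_set U f) (kappa2 f \<nu>) (W - (\<lambda>t. \<gamma> (\<sigma> * t)) ` {0..<\<epsilon>})"
      unfolding J2 kappa2_eq by (rule ext) simp
    have U1: "unbounded_near U (sing_set U f) (kappa1 f \<nu>) (\<gamma> (\<sigma> * t))"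
      if "t \<in> {-\<epsilon><..0}" "\<gamma> (\<sigma> * t) \<in> W" for t
      unfolding kappa1_eq using that s0 by (intro unb) (auto simp: \<sigma>_def)
    have U2: "unbounded_near U (sing_set U f) (kappa2 f \<nu>) (\<gamma> (\<sigma> * t))"
      if "t \<in> {0..<\<epsilon>}" "\<gamma> (\<sigma> * t) \<in> W" for t
      unfolding kappa2_eq using that s0 by (intro unb) (auto simp: \<sigma>_def)
    have "\<not> non_front (2 * l) f \<nu> \<gamma> \<eta>" for l
    proof -
      have "2 * k + 1 \<noteq> 2 * l" by presburger
      then show ?thesis using non_front_unique[OF odd] by blast
    qed
    then show ?thesis
      using W E1 E2 U1 U2 \<sigma>(1) unfolding Let_def by (intro exI[of _ W]) blast
  qed
qed

end
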